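(* Let $\mathcal{C}$ be an abelian monoidal category, let $\mathcal{M}$ be an abelian left $\mathcal{C}$-module category whose action functor $\triangleright$ is right exact in both variables, and let $T$ be a right exact lax $\mathcal{C}$-module monad on $\mathcal{M}$. Then the left multiactegory $\mathbf{M}^{\varphi}$ of $T$-modules and multilinear morphisms, over the multicategory $\mathbf{C}$ associated to $\mathcal{C}$, is representable.
   Context: All categories and functors are linear over a fixed field. A lax $\mathcal{C}$-module monad $T=(T,\mu,\eta)$ is a monad with coherent natural maps $V\triangleright T(M)\to T(V\triangleright M)$ for which $\mu,\eta$ are $\mathcal{C}$-module transformations. $\mathbf{EM}(T)$ is the category of $T$-modules $(X,\nabla_X\colon T(X)\to X)$. Write $\varphi\colon V_1\triangleright\cdots\triangleright V_n\triangleright T(X)\to T(V_1\triangleright\cdots\triangleright V_n\triangleright X)$ for the map obtained by iterating the lax structure (rightmost parenthesization throughout). The multicategory $\mathbf{C}$ has the objects of $\mathcal{C}$, and $\mathbf{C}(V_1,\dots,V_n;W)=\mathcal{C}(V_1\otimes(\cdots(V_{n-1}\otimes V_n)\cdots),W)$ (with $\mathbb{1}$ for $n=0$); its universal multimorphisms are the isomorphisms, and a representation of $\mathbf{C}$ is a choice of a universal multimorphism out of every finite sequence of objects. The left multiactegory $\mathbf{M}^{\varphi}$ over $\mathbf{C}$ has as objects the $T$-modules; for objects $V_1,\dots,V_n\in\mathcal{C}$ ($n\ge0$) and $X,Y\in\mathbf{EM}(T)$, the set $\mathbf{M}^{\varphi}(V_1,\dots,V_n;X;Y)$ consists of the multilinear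 morphisms, i.e. morphisms $f\colon V_1\triangleright\cdots\triangleright V_n\triangleright X\to Y$ in $\mathcal{M}$ with $$f\circ(V_1\triangleright\cdots\triangleright V_n\triangleright\nabla_X)=\nabla_Y\circ T(f)\circ\varphi .$$ Multimorphisms can be composed with multimorphisms of $\mathbf{C}$ in the $\mathcal{C}$-variables and with multilinear morphisms in the module variable, by substitution and the coherence isomorphisms of $\mathcal{M}$. A multimorphism $\pi\in\mathbf{M}^{\varphi}(\vec V;X;Z)$ is universal if precomposition with $\pi$ gives bijections $\mathbf{M}^{\varphi}(\vec U;Z;Y)\to\mathbf{M}^{\varphi}(\vec U,\vec V;X;Y)$ for all finite sequences $\vec U$ and all $Y$. A multimorphism $\rho\in\mathbf{C}(\vec V;W)$ is universal in $\mathbf{M}^{\varphi}$ if it induces bijections $\mathbf{M}^{\varphi}(\vec U,W,\vec U';X;Y)\to\mathbf{M}^{\varphi}(\vec U,\vec V,\vec U';X;Y)$ for all $\vec U,\vec U',X,Y$. $\mathbf{M}^{\varphi}$ is representable (with respect to a representation of $\mathbf{C}$) if for every finite sequence $\vec V$ in $\mathcal{C}$ and every $X\in\mathbf{EM}(T)$ there is a universal multimorphism with domain $(\vec V;X)$, and all multimorphisms in the chosen representation of $\mathbf{C}$ are universal in $\mathbf{M}^{\varphi}$. *)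

theory Defs
  imports "HOL-Algebra.Module"
begin

section \<open>Categories linear over a field\<close>

text \<open>
  A category has a set of objects, a set of arrows with domain and codomain, and composition
  \<open>g \<cdot> f\<close> in the usual order. The operations are meaningful only on arrows (composable, resp.
  parallel ones); their values elsewhere are never constrained. The linear structure on the
  hom-sets is part of the data.
\<close>

record ('k, 'o, 'a) lincat =
  Obj :: "'o set"
  Arr :: "'a set"
  Dom :: "'a \<Rightarrow> 'o"
  Cod :: "'a \<Rightarrow> 'o"
  Ide :: "'o \<Rightarrow> 'a"
  Cmp :: "'a \<Rightarrow> 'a \<Rightarrow> 'a" (infixr "\<cdot>\<index>" 70)
  HZero :: "'o \<Rightarrow> 'o \<Rightarrow> 'a"
  HAdd :: "'a \<Rightarrow> 'a \<Rightarrow> 'a"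
  HScale :: "'k \<Rightarrow> 'a \<Rightarrow> 'a"

definition Hom :: "('k, 'o, 'a, 'e) lincat_scheme \<Rightarrow> 'o \<Rightarrow> 'o \<Rightarrow> 'a set" where
  "Hom C A B = {f \<in> Arr C. Dom C f = A \<and> Cod C f = B}"

text \<open>
  A hom-set as a module in the sense of HOL-Algebra. The fields \<open>mult\<close> and \<open>one\<close> play no role for
  modules.
\<close>

definition hom_module ::
    "('k, 'o, 'a, 'e) lincat_scheme \<Rightarrow> 'o \<Rightarrow> 'o \<Rightarrow> ('k, 'a) module" where
  "hom_module C A B =
    \<lparr>carrier = Hom C A B, monoid.mult = undefined, one = undefined,
     zero = HZero C A B, add = HAdd C, smult = HScale C\<rparr>"

locale linear_category =
  fixes K :: "('k, 'r) ring_scheme" and C :: "('k, 'o, 'a, 'e) lincat_scheme" (structure)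
  assumes field: "field K"
    and arr_dom_cod: "f \<in> Arr C \<Longrightarrow> Dom C f \<in> Obj C \<and> Cod C f \<in> Obj C"
    and ide_hom: "A \<in> Obj C \<Longrightarrow> Ide C A \<in> Hom C A A"
    and cmp_hom: "f \<in> Hom C A B \<Longrightarrow> g \<in> Hom C B D \<Longrightarrow> g \<cdot> f \<in> Hom C A D"
    and cmp_ide: "f \<in> Hom C A B \<Longrightarrow> f \<cdot> Ide C A = f"
    and ide_cmp: "f \<in> Hom C A B \<Longrightarrow> Ide C B \<cdot> f = f"
    and cmp_assoc: "f \<in> Hom C A B \<Longrightarrow> g \<in> Hom C B D \<Longrightarrow> h \<in> Hom C D E
      \<Longrightarrow> (h \<cdot> g) \<cdot> f = h \<cdot> (g \<cdot> f)"
    and hom_module: "A \<in> Obj C \<Longrightarrow> B \<in> Obj C \<Longrightarrow> module K (hom_module C A B)"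
    and add_cmp: "f \<in> Hom C A B \<Longrightarrow> g \<in> Hom C B D \<Longrightarrow> g' \<in> Hom C B D
      \<Longrightarrow> HAdd C g g' \<cdot> f = HAdd C (g \<cdot> f) (g' \<cdot> f)"
    and cmp_add: "f \<in> Hom C A B \<Longrightarrow> f' \<in> Hom C A B \<Longrightarrow> g \<in> Hom C B D
      \<Longrightarrow> g \<cdot> HAdd C f f' = HAdd C (g \<cdot> f) (g \<cdot> f')"
    and scale_cmp: "c \<in> carrier K \<Longrightarrow> f \<in> Hom C A B \<Longrightarrow> g \<in> Hom C B D
      \<Longrightarrow> HScale C c g \<cdot> f = HScale C c (g \<cdot> f)"
    and cmp_scale: "c \<in> carrier K \<Longrightarrow> f \<in> Hom C A B \<Longrightarrow> g \<in> Hom C B D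
      \<Longrightarrow> g \<cdot> HScale C c f = HScale C c (g \<cdot> f)"

definition inverse_arrows :: "('k, 'o, 'a, 'e) lincat_scheme \<Rightarrow> 'a \<Rightarrow> 'a \<Rightarrow> bool" where
  "inverse_arrows C f g \<longleftrightarrow> f \<in> Arr C \<and> g \<in> Hom C (Cod C f) (Dom C f) \<and>
     g \<cdot>\<^bsub>C\<^esub> f = Ide C (Dom C f) \<and> f \<cdot>\<^bsub>C\<^esub> g = Ide C (Cod C f)"

definition is_iso :: "('k, 'o, 'a, 'e) lincat_scheme \<Rightarrow> 'a \<Rightarrow> bool" where
  "is_iso C f \<longleftrightarrow> (\<exists>g. inverse_arrows C f g)"

definition inverse_arrow :: "('k, 'o, 'a, 'e) lincat_scheme \<Rightarrow> 'a \<Rightarrow> 'a" where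
  "inverse_arrow C f = (THE g. inverse_arrows C f g)"

definition is_mono :: "('k, 'o, 'a, 'e) lincat_scheme \<Rightarrow> 'a \<Rightarrow> bool" where
  "is_mono C f \<longleftrightarrow> f \<in> Arr C \<and>
     (\<forall>X. \<forall>g \<in> Hom C X (Dom C f). \<forall>h \<in> Hom C X (Dom C f). f \<cdot>\<^bsub>C\<^esub> g = f \<cdot>\<^bsub>C\<^esub> h \<longrightarrow> g = h)"

definition is_epi :: "('k, 'o, 'a, 'e) lincat_scheme \<Rightarrow> 'a \<Rightarrow> bool" where
  "is_epi C f \<longleftrightarrow> f \<in> Arr C \<and>
     (\<forall>X. \<forall>g \<in> Hom C (Cod C f) X. \<forall>h \<in> Hom C (Cod C f) X. g \<cdot>\<^bsub>C\<^esub> f = h \<cdot>\<^bsub>C\<^esub> f \<longrightarrow> g = h)"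

definition is_kernel :: "('k, 'o, 'a, 'e) lincat_scheme \<Rightarrow> 'a \<Rightarrow> 'a \<Rightarrow> bool" where
  "is_kernel C k f \<longleftrightarrow> f \<in> Arr C \<and> k \<in> Arr C \<and> Cod C k = Dom C f \<and>
     f \<cdot>\<^bsub>C\<^esub> k = HZero C (Dom C k) (Cod C f) \<and>
     (\<forall>X. \<forall>h \<in> Hom C X (Dom C f). f \<cdot>\<^bsub>C\<^esub> h = HZero C X (Cod C f) \<longrightarrow>
        (\<exists>!u. u \<in> Hom C X (Dom C k) \<and> k \<cdot>\<^bsub>C\<^esub> u = h))"

definition is_cokernel :: "('k, 'o, 'a, 'e) lincat_scheme \<Rightarrow> 'a \<Rightarrow> 'a \<Rightarrow> bool" where
  "is_cokernel C c f \<longleftrightarrow> f \<in> Arr C \<and> c \<in> Arr C \<and> Dom C c = Cod C f \<and>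
     c \<cdot>\<^bsub>C\<^esub> f = HZero C (Dom C f) (Cod C c) \<and>
     (\<forall>X. \<forall>h \<in> Hom C (Cod C f) X. h \<cdot>\<^bsub>C\<^esub> f = HZero C (Dom C f) X \<longrightarrow>
        (\<exists>!u. u \<in> Hom C (Cod C c) X \<and> u \<cdot>\<^bsub>C\<^esub> c = h))"

definition is_zero_object :: "('k, 'o, 'a, 'e) lincat_scheme \<Rightarrow> 'o \<Rightarrow> bool" where
  "is_zero_object C Z \<longleftrightarrow> Z \<in> Obj C \<and>
     (\<forall>A \<in> Obj C. (\<exists>!f. f \<in> Hom C A Z) \<and> (\<exists>!f. f \<in> Hom C Z A))"

definition is_biproduct ::
    "('k, 'o, 'a, 'e) lincat_scheme \<Rightarrow> 'o \<Rightarrow> 'o \<Rightarrow> 'o \<Rightarrow> 'a \<Rightarrow> 'a \<Rightarrow> 'a \<Rightarrow> 'a \<Rightarrow> bool" where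
  "is_biproduct C A B P i j p q \<longleftrightarrow> P \<in> Obj C \<and>
     i \<in> Hom C A P \<and> j \<in> Hom C B P \<and> p \<in> Hom C P A \<and> q \<in> Hom C P B \<and>
     p \<cdot>\<^bsub>C\<^esub> i = Ide C A \<and> q \<cdot>\<^bsub>C\<^esub> j = Ide C B \<and>
     q \<cdot>\<^bsub>C\<^esub> i = HZero C A B \<and> p \<cdot>\<^bsub>C\<^esub> j = HZero C B A \<and>
     HAdd C (i \<cdot>\<^bsub>C\<^esub> p) (j \<cdot>\<^bsub>C\<^esub> q) = Ide C P"

locale abelian_category = linear_category K C
  for K :: "('k, 'r) ring_scheme" and C :: "('k, 'o, 'a, 'e) lincat_scheme" (structure) +
  assumes ex_zero_object: "\<exists>Z. is_zero_object C Z"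
    and ex_biproduct: "A \<in> Obj C \<Longrightarrow> B \<in> Obj C \<Longrightarrow> \<exists>P i j p q. is_biproduct C A B P i j p q"
    and ex_kernel: "f \<in> Arr C \<Longrightarrow> \<exists>k. is_kernel C k f"
    and ex_cokernel: "f \<in> Arr C \<Longrightarrow> \<exists>c. is_cokernel C c f"
    and mono_is_kernel: "is_mono C f \<Longrightarrow> \<exists>g. is_kernel C f g"
    and epi_is_cokernel: "is_epi C f \<Longrightarrow> \<exists>g. is_cokernel C f g"


section \<open>Linear and right exact functors\<close>

locale linear_functor = C: linear_category K C + D: linear_category K D
  for K :: "('k, 'r) ring_scheme" and C :: "('k, 'o, 'a, 'e) lincat_scheme"
    and D :: "('k, 'p, 'b, 'd) lincat_scheme" and Fo :: "'o \<Rightarrow> 'p" and Fa :: "'a \<Rightarrow> 'b" +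
  assumes fun_obj: "A \<in> Obj C \<Longrightarrow> Fo A \<in> Obj D"
    and fun_hom: "f \<in> Hom C A B \<Longrightarrow> Fa f \<in> Hom D (Fo A) (Fo B)"
    and fun_ide: "A \<in> Obj C \<Longrightarrow> Fa (Ide C A) = Ide D (Fo A)"
    and fun_cmp: "f \<in> Hom C A B \<Longrightarrow> g \<in> Hom C B E \<Longrightarrow> Fa (g \<cdot>\<^bsub>C\<^esub> f) = Fa g \<cdot>\<^bsub>D\<^esub> Fa f"
    and fun_add: "f \<in> Hom C A B \<Longrightarrow> g \<in> Hom C A B \<Longrightarrow> Fa (HAdd C f g) = HAdd D (Fa f) (Fa g)"
    and fun_scale: "c \<in> carrier K \<Longrightarrow> f \<in> Hom C A B \<Longrightarrow> Fa (HScale C c f) = HScale D c (Fa f)"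

text \<open>The image of an arrow is the kernel of its cokernel.\<close>

definition is_image :: "('k, 'o, 'a, 'e) lincat_scheme \<Rightarrow> 'a \<Rightarrow> 'a \<Rightarrow> bool" where
  "is_image C i f \<longleftrightarrow> (\<exists>c. is_cokernel C c f \<and> is_kernel C i c)"

definition exact_at :: "('k, 'o, 'a, 'e) lincat_scheme \<Rightarrow> 'a \<Rightarrow> 'a \<Rightarrow> bool" where
  "exact_at C f g \<longleftrightarrow> f \<in> Arr C \<and> g \<in> Arr C \<and> Cod C f = Dom C g \<and>
     (\<exists>i. is_image C i f \<and> is_kernel C i g)"

text \<open>
  Right exactness: every short exact sequence \<open>0 \<rightarrow> A \<rightarrow> B \<rightarrow> E \<rightarrow> 0\<close> is sent to an exact sequence
  \<open>F A \<rightarrow> F B \<rightarrow> F E \<rightarrow> 0\<close>.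
\<close>

locale right_exact_functor = linear_functor K C D Fo Fa
  for K :: "('k, 'r) ring_scheme" and C :: "('k, 'o, 'a, 'e) lincat_scheme"
    and D :: "('k, 'p, 'b, 'd) lincat_scheme" and Fo :: "'o \<Rightarrow> 'p" and Fa :: "'a \<Rightarrow> 'b" +
  assumes right_exact: "is_mono C f \<Longrightarrow> exact_at C f g \<Longrightarrow> is_epi C g
      \<Longrightarrow> exact_at D (Fa f) (Fa g) \<and> is_epi D (Fa g)"

locale bilinear_functor = C: linear_category K C + D: linear_category K D + E: linear_category K E
  for K :: "('k, 'r) ring_scheme" and C :: "('k, 'o, 'a, 'e) lincat_scheme"
    and D :: "('k, 'p, 'b, 'd) lincat_scheme" and E :: "('k, 'q, 'c, 'h) lincat_scheme"
    and Fo :: "'o \<Rightarrow> 'p \<Rightarrow> 'q" and Fa :: "'a \<Rightarrow> 'b \<Rightarrow> 'c" +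
  assumes bifun_obj: "A \<in> Obj C \<Longrightarrow> B \<in> Obj D \<Longrightarrow> Fo A B \<in> Obj E"
    and bifun_hom: "f \<in> Hom C A A' \<Longrightarrow> g \<in> Hom D B B' \<Longrightarrow> Fa f g \<in> Hom E (Fo A B) (Fo A' B')"
    and bifun_ide: "A \<in> Obj C \<Longrightarrow> B \<in> Obj D \<Longrightarrow> Fa (Ide C A) (Ide D B) = Ide E (Fo A B)"
    and bifun_cmp: "f \<in> Hom C A A' \<Longrightarrow> f' \<in> Hom C A' A'' \<Longrightarrow> g \<in> Hom D B B' \<Longrightarrow> g' \<in> Hom D B' B''
      \<Longrightarrow> Fa (f' \<cdot>\<^bsub>C\<^esub> f) (g' \<cdot>\<^bsub>D\<^esub> g) = Fa f' g' \<cdot>\<^bsub>E\<^esub> Fa f g"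
    and bifun_add_left: "f \<in> Hom C A A' \<Longrightarrow> f' \<in> Hom C A A' \<Longrightarrow> g \<in> Hom D B B'
      \<Longrightarrow> Fa (HAdd C f f') g = HAdd E (Fa f g) (Fa f' g)"
    and bifun_add_right: "f \<in> Hom C A A' \<Longrightarrow> g \<in> Hom D B B' \<Longrightarrow> g' \<in> Hom D B B'
      \<Longrightarrow> Fa f (HAdd D g g') = HAdd E (Fa f g) (Fa f g')"
    and bifun_scale_left: "c \<in> carrier K \<Longrightarrow> f \<in> Hom C A A' \<Longrightarrow> g \<in> Hom D B B'
      \<Longrightarrow> Fa (HScale C c f) g = HScale E c (Fa f g)"
    and bifun_scale_right: "c \<in> carrier K \<Longrightarrow> f \<in> Hom C A A' \<Longrightarrow> g \<in> Hom D B B'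
      \<Longrightarrow> Fa f (HScale D c g) = HScale E c (Fa f g)"


section \<open>Monoidal categories and module categories\<close>

record ('k, 'c, 'f) moncat = "('k, 'c, 'f) lincat" +
  tens_o :: "'c \<Rightarrow> 'c \<Rightarrow> 'c" (infixr "\<boxtimes>\<index>" 75)
  tens_a :: "'f \<Rightarrow> 'f \<Rightarrow> 'f" (infixr "\<boxtimes>\<^sub>a\<index>" 75)
  tunit :: 'c
  assoc :: "'c \<Rightarrow> 'c \<Rightarrow> 'c \<Rightarrow> 'f"
  lunit :: "'c \<Rightarrow> 'f"
  runit :: "'c \<Rightarrow> 'f"

locale monoidal_category =
  linear_category K C + tensor: bilinear_functor K C C C "tens_o C" "tens_a C"
  for K :: "('k, 'r) ring_scheme" and C :: "('k, 'c, 'f, 'e) moncat_scheme" (structure) +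
  assumes tunit_obj: "tunit C \<in> Obj C"
    and assoc_hom: "U \<in> Obj C \<Longrightarrow> V \<in> Obj C \<Longrightarrow> W \<in> Obj C
      \<Longrightarrow> assoc C U V W \<in> Hom C ((U \<boxtimes> V) \<boxtimes> W) (U \<boxtimes> (V \<boxtimes> W))"
    and assoc_iso: "U \<in> Obj C \<Longrightarrow> V \<in> Obj C \<Longrightarrow> W \<in> Obj C \<Longrightarrow> is_iso C (assoc C U V W)"
    and assoc_natural: "u \<in> Hom C U U' \<Longrightarrow> v \<in> Hom C V V' \<Longrightarrow> w \<in> Hom C W W'
      \<Longrightarrow> assoc C U' V' W' \<cdot> ((u \<boxtimes>\<^sub>a v) \<boxtimes>\<^sub>a w) = (u \<boxtimes>\<^sub>a (v \<boxtimes>\<^sub>a w)) \<cdot> assoc C U V W"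
    and lunit_hom: "V \<in> Obj C \<Longrightarrow> lunit C V \<in> Hom C (tunit C \<boxtimes> V) V"
    and lunit_iso: "V \<in> Obj C \<Longrightarrow> is_iso C (lunit C V)"
    and lunit_natural: "v \<in> Hom C V V'
      \<Longrightarrow> lunit C V' \<cdot> (Ide C (tunit C) \<boxtimes>\<^sub>a v) = v \<cdot> lunit C V"
    and runit_hom: "V \<in> Obj C \<Longrightarrow> runit C V \<in> Hom C (V \<boxtimes> tunit C) V"
    and runit_iso: "V \<in> Obj C \<Longrightarrow> is_iso C (runit C V)"
    and runit_natural: "v \<in> Hom C V V'
      \<Longrightarrow> runit C V' \<cdot> (v \<boxtimes>\<^sub>a Ide C (tunit C)) = v \<cdot> runit C V"
    and pentagon: "U \<in> Obj C \<Longrightarrow> V \<in> Obj C \<Longrightarrow> W \<in> Obj C \<Longrightarrow> X \<in> Obj C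
      \<Longrightarrow> (Ide C U \<boxtimes>\<^sub>a assoc C V W X) \<cdot> assoc C U (V \<boxtimes> W) X \<cdot> (assoc C U V W \<boxtimes>\<^sub>a Ide C X)
        = assoc C U V (W \<boxtimes> X) \<cdot> assoc C (U \<boxtimes> V) W X"
    and triangle: "V \<in> Obj C \<Longrightarrow> W \<in> Obj C
      \<Longrightarrow> (Ide C V \<boxtimes>\<^sub>a lunit C W) \<cdot> assoc C V (tunit C) W = runit C V \<boxtimes>\<^sub>a Ide C W"

text \<open>
  The carrier category \<open>M\<close> of a left module category together with the action functor
  \<open>C \<times> M \<rightarrow> M\<close> (on objects and on pairs of arrows) and the coherence isomorphisms
  \<open>(V \<boxtimes> W) \<triangleright> X \<rightarrow> V \<triangleright> (W \<triangleright> X)\<close> and \<open>\<one> \<triangleright> X \<rightarrow> X\<close>.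
\<close>

record ('k, 'm, 'g, 'c, 'f) modcat = "('k, 'm, 'g) lincat" +
  act_o :: "'c \<Rightarrow> 'm \<Rightarrow> 'm" (infixr "\<triangleright>\<index>" 75)
  act_a :: "'f \<Rightarrow> 'g \<Rightarrow> 'g" (infixr "\<triangleright>\<^sub>a\<index>" 75)
  massoc :: "'c \<Rightarrow> 'c \<Rightarrow> 'm \<Rightarrow> 'g"
  munit :: "'m \<Rightarrow> 'g"

locale module_category =
  C: monoidal_category K C + M: linear_category K M +
  action: bilinear_functor K C M M "act_o M" "act_a M"
  for K :: "('k, 'r) ring_scheme" and C :: "('k, 'c, 'f, 'e) moncat_scheme"
    and M :: "('k, 'm, 'g, 'c, 'f, 'd) modcat_scheme" (structure) +
  assumes massoc_hom: "V \<in> Obj C \<Longrightarrow> W \<in> Obj C \<Longrightarrow> X \<in> Obj M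
      \<Longrightarrow> massoc M V W X \<in> Hom M ((V \<boxtimes>\<^bsub>C\<^esub> W) \<triangleright> X) (V \<triangleright> (W \<triangleright> X))"
    and massoc_iso: "V \<in> Obj C \<Longrightarrow> W \<in> Obj C \<Longrightarrow> X \<in> Obj M \<Longrightarrow> is_iso M (massoc M V W X)"
    and massoc_natural: "v \<in> Hom C V V' \<Longrightarrow> w \<in> Hom C W W' \<Longrightarrow> x \<in> Hom M X X'
      \<Longrightarrow> massoc M V' W' X' \<cdot> ((v \<boxtimes>\<^sub>a\<^bsub>C\<^esub> w) \<triangleright>\<^sub>a x) = (v \<triangleright>\<^sub>a (w \<triangleright>\<^sub>a x)) \<cdot> massoc M V W X"
    and munit_hom: "X \<in> Obj M \<Longrightarrow> munit M X \<in> Hom M (tunit C \<triangleright> X) X"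
    and munit_iso: "X \<in> Obj M \<Longrightarrow> is_iso M (munit M X)"
    and munit_natural: "x \<in> Hom M X X'
      \<Longrightarrow> munit M X' \<cdot> (Ide C (tunit C) \<triangleright>\<^sub>a x) = x \<cdot> munit M X"
    and mpentagon: "U \<in> Obj C \<Longrightarrow> V \<in> Obj C \<Longrightarrow> W \<in> Obj C \<Longrightarrow> X \<in> Obj M
      \<Longrightarrow> (Ide C U \<triangleright>\<^sub>a massoc M V W X) \<cdot> massoc M U (V \<boxtimes>\<^bsub>C\<^esub> W) X \<cdot> (assoc C U V W \<triangleright>\<^sub>a Ide M X)
        = massoc M U V (W \<triangleright> X) \<cdot> massoc M (U \<boxtimes>\<^bsub>C\<^esub> V) W X"
    and mtriangle: "V \<in> Obj C \<Longrightarrow> X \<in> Obj M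
      \<Longrightarrow> (Ide C V \<triangleright>\<^sub>a munit M X) \<cdot> massoc M V (tunit C) X = runit C V \<triangleright>\<^sub>a Ide M X"

locale abelian_monoidal_category = abelian_category K C + monoidal_category K C
  for K :: "('k, 'r) ring_scheme" and C :: "('k, 'c, 'f, 'e) moncat_scheme"

locale abelian_module_category = module_category K C M + abelian_category K M
  for K :: "('k, 'r) ring_scheme" and C :: "('k, 'c, 'f, 'e) moncat_scheme"
    and M :: "('k, 'm, 'g, 'c, 'f, 'd) modcat_scheme"

definition action_right_exact_in_both_variables ::
    "('k, 'r) ring_scheme \<Rightarrow> ('k, 'c, 'f, 'e) moncat_scheme
      \<Rightarrow> ('k, 'm, 'g, 'c, 'f, 'd) modcat_scheme \<Rightarrow> bool" where
  "action_right_exact_in_both_variables K C M \<longleftrightarrow>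
     (\<forall>V \<in> Obj C. right_exact_functor K M M (\<lambda>X. V \<triangleright>\<^bsub>M\<^esub> X) (\<lambda>x. Ide C V \<triangleright>\<^sub>a\<^bsub>M\<^esub> x)) \<and>
     (\<forall>X \<in> Obj M. right_exact_functor K C M (\<lambda>V. V \<triangleright>\<^bsub>M\<^esub> X) (\<lambda>v. v \<triangleright>\<^sub>a\<^bsub>M\<^esub> Ide M X))"


section \<open>Lax module monads and their modules\<close>

text \<open>The field \<open>lax\<close> holds the maps \<open>V \<triangleright> T X \<rightarrow> T (V \<triangleright> X)\<close>.\<close>

record ('c, 'm, 'g) lax_monad =
  T_o :: "'m \<Rightarrow> 'm"
  T_a :: "'g \<Rightarrow> 'g"
  mu :: "'m \<Rightarrow> 'g"
  eta :: "'m \<Rightarrow> 'g"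
  lax :: "'c \<Rightarrow> 'm \<Rightarrow> 'g"

locale lax_module_monad =
  module_category K C M + T: linear_functor K M M "T_o T" "T_a T"
  for K :: "('k, 'r) ring_scheme" and C :: "('k, 'c, 'f, 'e) moncat_scheme"
    and M :: "('k, 'm, 'g, 'c, 'f, 'd) modcat_scheme" (structure)
    and T :: "('c, 'm, 'g, 't) lax_monad_scheme" +
  assumes mu_hom: "X \<in> Obj M \<Longrightarrow> mu T X \<in> Hom M (T_o T (T_o T X)) (T_o T X)"
    and mu_natural: "x \<in> Hom M X Y \<Longrightarrow> mu T Y \<cdot> T_a T (T_a T x) = T_a T x \<cdot> mu T X"
    and eta_hom: "X \<in> Obj M \<Longrightarrow> eta T X \<in> Hom M X (T_o T X)"
    and eta_natural: "x \<in> Hom M X Y \<Longrightarrow> eta T Y \<cdot> x = T_a T x \<cdot> eta T X"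
    and mu_assoc: "X \<in> Obj M \<Longrightarrow> mu T X \<cdot> T_a T (mu T X) = mu T X \<cdot> mu T (T_o T X)"
    and mu_eta_left: "X \<in> Obj M \<Longrightarrow> mu T X \<cdot> eta T (T_o T X) = Ide M (T_o T X)"
    and mu_eta_right: "X \<in> Obj M \<Longrightarrow> mu T X \<cdot> T_a T (eta T X) = Ide M (T_o T X)"
    and lax_hom: "V \<in> Obj C \<Longrightarrow> X \<in> Obj M \<Longrightarrow> lax T V X \<in> Hom M (V \<triangleright> T_o T X) (T_o T (V \<triangleright> X))"
    and lax_natural: "v \<in> Hom C V V' \<Longrightarrow> x \<in> Hom M X X'
      \<Longrightarrow> lax T V' X' \<cdot> (v \<triangleright>\<^sub>a T_a T x) = T_a T (v \<triangleright>\<^sub>a x) \<cdot> lax T V X"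
    and lax_massoc: "V \<in> Obj C \<Longrightarrow> W \<in> Obj C \<Longrightarrow> X \<in> Obj M
      \<Longrightarrow> T_a T (massoc M V W X) \<cdot> lax T (V \<boxtimes>\<^bsub>C\<^esub> W) X
        = lax T V (W \<triangleright> X) \<cdot> (Ide C V \<triangleright>\<^sub>a lax T W X) \<cdot> massoc M V W (T_o T X)"
    and lax_munit: "X \<in> Obj M \<Longrightarrow> T_a T (munit M X) \<cdot> lax T (tunit C) X = munit M (T_o T X)"
    and mu_module: "V \<in> Obj C \<Longrightarrow> X \<in> Obj M
      \<Longrightarrow> mu T (V \<triangleright> X) \<cdot> T_a T (lax T V X) \<cdot> lax T V (T_o T X)
        = lax T V X \<cdot> (Ide C V \<triangleright>\<^sub>a mu T X)"
    and eta_module: "V \<in> Obj C \<Longrightarrow> X \<in> Obj M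
      \<Longrightarrow> lax T V X \<cdot> (Ide C V \<triangleright>\<^sub>a eta T X) = eta T (V \<triangleright> X)"

locale right_exact_lax_module_monad =
  lax_module_monad K C M T + right_exact_functor K M M "T_o T" "T_a T"
  for K :: "('k, 'r) ring_scheme" and C :: "('k, 'c, 'f, 'e) moncat_scheme"
    and M :: "('k, 'm, 'g, 'c, 'f, 'd) modcat_scheme"
    and T :: "('c, 'm, 'g, 't) lax_monad_scheme"

definition EM_obj :: "('k, 'm, 'g, 'd) lincat_scheme \<Rightarrow> ('c, 'm, 'g, 't) lax_monad_scheme
    \<Rightarrow> ('m \<times> 'g) set" where
  "EM_obj M T = {(X, a). X \<in> Obj M \<and> a \<in> Hom M (T_o T X) X \<and>
     a \<cdot>\<^bsub>M\<^esub> eta T X = Ide M X \<and> a \<cdot>\<^bsub>M\<^esub> mu T X = a \<cdot>\<^bsub>M\<^esub> T_a T a}"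


section \<open>The multicategory of a monoidal category\<close>

fun tens_list :: "('k, 'c, 'f, 'e) moncat_scheme \<Rightarrow> 'c list \<Rightarrow> 'c" where
  "tens_list C [] = tunit C"
| "tens_list C [V] = V"
| "tens_list C (V # W # Vs) = V \<boxtimes>\<^bsub>C\<^esub> tens_list C (W # Vs)"

definition multi_hom :: "('k, 'c, 'f, 'e) moncat_scheme \<Rightarrow> 'c list \<Rightarrow> 'c \<Rightarrow> 'f set" where
  "multi_hom C Vs W = Hom C (tens_list C Vs) W"

text \<open>
  A representation chooses, for every finite sequence of objects, a target together with a
  universal multimorphism; the universal multimorphisms of this multicategory are the isomorphisms.
\<close>

definition is_representation ::
    "('k, 'c, 'f, 'e) moncat_scheme \<Rightarrow> ('c list \<Rightarrow> 'c \<times> 'f) \<Rightarrow> bool" where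
  "is_representation C R \<longleftrightarrow> (\<forall>Vs \<in> lists (Obj C). fst (R Vs) \<in> Obj C \<and>
     snd (R Vs) \<in> multi_hom C Vs (fst (R Vs)) \<and> is_iso C (snd (R Vs)))"


section \<open>The multiactegory of multilinear morphisms\<close>

fun act_list :: "('k, 'm, 'g, 'c, 'f, 'd) modcat_scheme \<Rightarrow> 'c list \<Rightarrow> 'm \<Rightarrow> 'm" where
  "act_list M [] X = X"
| "act_list M (V # Vs) X = V \<triangleright>\<^bsub>M\<^esub> act_list M Vs X"

text \<open>The arrow \<open>V\<^sub>1 \<triangleright> \<dots> \<triangleright> V\<^sub>n \<triangleright> x\<close>.\<close>

fun act_list_arr :: "('k, 'c, 'f, 'e) moncat_scheme \<Rightarrow> ('k, 'm, 'g, 'c, 'f, 'd) modcat_scheme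
    \<Rightarrow> 'c list \<Rightarrow> 'g \<Rightarrow> 'g" where
  "act_list_arr C M [] x = x"
| "act_list_arr C M (V # Vs) x = Ide C V \<triangleright>\<^sub>a\<^bsub>M\<^esub> act_list_arr C M Vs x"

text \<open>The iterated lax structure \<open>V\<^sub>1 \<triangleright> \<dots> \<triangleright> V\<^sub>n \<triangleright> T X \<rightarrow> T (V\<^sub>1 \<triangleright> \<dots> \<triangleright> V\<^sub>n \<triangleright> X)\<close>.\<close>

fun lax_list :: "('k, 'c, 'f, 'e) moncat_scheme \<Rightarrow> ('k, 'm, 'g, 'c, 'f, 'd) modcat_scheme
    \<Rightarrow> ('c, 'm, 'g, 't) lax_monad_scheme \<Rightarrow> 'c list \<Rightarrow> 'm \<Rightarrow> 'g" where
  "lax_list C M T [] X = Ide M (T_o T X)"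
| "lax_list C M T (V # Vs) X =
     lax T V (act_list M Vs X) \<cdot>\<^bsub>M\<^esub> (Ide C V \<triangleright>\<^sub>a\<^bsub>M\<^esub> lax_list C M T Vs X)"

definition multilinear :: "('k, 'c, 'f, 'e) moncat_scheme
    \<Rightarrow> ('k, 'm, 'g, 'c, 'f, 'd) modcat_scheme \<Rightarrow> ('c, 'm, 'g, 't) lax_monad_scheme
    \<Rightarrow> 'c list \<Rightarrow> 'm \<times> 'g \<Rightarrow> 'm \<times> 'g \<Rightarrow> 'g set" where
  "multilinear C M T Vs X Y = {f \<in> Hom M (act_list M Vs (fst X)) (fst Y).
     f \<cdot>\<^bsub>M\<^esub> act_list_arr C M Vs (snd X) = snd Y \<cdot>\<^bsub>M\<^esub> T_a T f \<cdot>\<^bsub>M\<^esub> lax_list C M T Vs (fst X)}"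

text \<open>
  The coherence isomorphism
  \<open>(V\<^sub>1 \<boxtimes> (\<dots> \<boxtimes> V\<^sub>n)) \<triangleright> X \<rightarrow> V\<^sub>1 \<triangleright> \<dots> \<triangleright> V\<^sub>n \<triangleright> X\<close>, which is \<open>\<one> \<triangleright> X \<rightarrow> X\<close> for \<open>n = 0\<close>.
\<close>

fun spread :: "('k, 'c, 'f, 'e) moncat_scheme \<Rightarrow> ('k, 'm, 'g, 'c, 'f, 'd) modcat_scheme
    \<Rightarrow> 'c list \<Rightarrow> 'm \<Rightarrow> 'g" where
  "spread C M [] X = munit M X"
| "spread C M [V] X = Ide M (V \<triangleright>\<^bsub>M\<^esub> X)"
| "spread C M (V # W # Vs) X =
     (Ide C V \<triangleright>\<^sub>a\<^bsub>M\<^esub> spread C M (W # Vs) X) \<cdot>\<^bsub>M\<^esub> massoc M V (tens_list C (W # Vs)) X"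

text \<open>
  Composition in the module variable: \<open>g : U\<^sub>1 \<triangleright> \<dots> \<triangleright> U\<^sub>m \<triangleright> Z \<rightarrow> Y\<close> after
  \<open>p : V\<^sub>1 \<triangleright> \<dots> \<triangleright> V\<^sub>n \<triangleright> X \<rightarrow> Z\<close>. No coherence isomorphism is needed, since
  \<open>act_list M (Us @ Vs) X\<close> and \<open>act_list M Us (act_list M Vs X)\<close> are the same object.
\<close>

definition comp_module_var :: "('k, 'c, 'f, 'e) moncat_scheme
    \<Rightarrow> ('k, 'm, 'g, 'c, 'f, 'd) modcat_scheme \<Rightarrow> 'c list \<Rightarrow> 'g \<Rightarrow> 'g \<Rightarrow> 'g" where
  "comp_module_var C M Us p g = g \<cdot>\<^bsub>M\<^esub> act_list_arr C M Us p"

text \<open>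
  Substitution of \<open>r : V\<^sub>1 \<boxtimes> (\<dots> \<boxtimes> V\<^sub>n) \<rightarrow> W\<close> for the variable \<open>W\<close> of
  \<open>f : U\<^sub>1 \<triangleright> \<dots> \<triangleright> W \<triangleright> U'\<^sub>1 \<triangleright> \<dots> \<triangleright> X \<rightarrow> Y\<close>.
\<close>

definition comp_base_var :: "('k, 'c, 'f, 'e) moncat_scheme
    \<Rightarrow> ('k, 'm, 'g, 'c, 'f, 'd) modcat_scheme
    \<Rightarrow> 'c list \<Rightarrow> 'c list \<Rightarrow> 'c list \<Rightarrow> 'm \<Rightarrow> 'f \<Rightarrow> 'g \<Rightarrow> 'g" where
  "comp_base_var C M Us Vs Us' X r f =
     f \<cdot>\<^bsub>M\<^esub> act_list_arr C M Us
       ((r \<triangleright>\<^sub>a\<^bsub>M\<^esub> Ide M (act_list M Us' X)) \<cdot>\<^bsub>M\<^esub>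
        inverse_arrow M (spread C M Vs (act_list M Us' X)))"

definition universal_module_multimorphism :: "('k, 'c, 'f, 'e) moncat_scheme
    \<Rightarrow> ('k, 'm, 'g, 'c, 'f, 'd) modcat_scheme \<Rightarrow> ('c, 'm, 'g, 't) lax_monad_scheme
    \<Rightarrow> 'c list \<Rightarrow> 'm \<times> 'g \<Rightarrow> 'm \<times> 'g \<Rightarrow> 'g \<Rightarrow> bool" where
  "universal_module_multimorphism C M T Vs X Z p \<longleftrightarrow> p \<in> multilinear C M T Vs X Z \<and>
     (\<forall>Us \<in> lists (Obj C). \<forall>Y \<in> EM_obj M T.
        bij_betw (comp_module_var C M Us p)
          (multilinear C M T Us Z Y) (multilinear C M T (Us @ Vs) X Y))"

definition universal_base_multimorphism :: "('k, 'c, 'f, 'e) moncat_scheme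
    \<Rightarrow> ('k, 'm, 'g, 'c, 'f, 'd) modcat_scheme \<Rightarrow> ('c, 'm, 'g, 't) lax_monad_scheme
    \<Rightarrow> 'c list \<Rightarrow> 'c \<Rightarrow> 'f \<Rightarrow> bool" where
  "universal_base_multimorphism C M T Vs W r \<longleftrightarrow> r \<in> multi_hom C Vs W \<and>
     (\<forall>Us \<in> lists (Obj C). \<forall>Us' \<in> lists (Obj C). \<forall>X \<in> EM_obj M T. \<forall>Y \<in> EM_obj M T.
        bij_betw (comp_base_var C M Us Vs Us' (fst X) r)
          (multilinear C M T (Us @ W # Us') X Y) (multilinear C M T (Us @ Vs @ Us') X Y))"

text \<open>Representability with respect to a representation \<open>R\<close> of the base multicategory.\<close>

definition multiactegory_representable :: "('k, 'c, 'f, 'e) moncat_scheme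
    \<Rightarrow> ('k, 'm, 'g, 'c, 'f, 'd) modcat_scheme \<Rightarrow> ('c, 'm, 'g, 't) lax_monad_scheme
    \<Rightarrow> ('c list \<Rightarrow> 'c \<times> 'f) \<Rightarrow> bool" where
  "multiactegory_representable C M T R \<longleftrightarrow>
     (\<forall>Vs \<in> lists (Obj C). \<forall>X \<in> EM_obj M T. \<exists>Z \<in> EM_obj M T. \<exists>p.
        universal_module_multimorphism C M T Vs X Z p) \<and>
     (\<forall>Vs \<in> lists (Obj C). universal_base_multimorphism C M T Vs (fst (R Vs)) (snd (R Vs)))"

end

theory Submission
  imports Defs
begin

text \<open>
  Let \<open>F\<close> be the iterated action of \<open>V\<^sub>1, \<dots>, V\<^sub>n\<close> and \<open>(X, a)\<close> a \<open>T\<close>-module. The universal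
  target is the coequalizer \<open>q : T F X \<rightarrow> Z\<close> in the underlying category of \<open>\<mu> \<circ> T \<phi>\<close> and \<open>T F a\<close>;
  since \<open>T\<close> preserves coequalizers, \<open>Z\<close> inherits a \<open>T\<close>-module structure, and the universal
  multimorphism is \<open>q \<circ> \<eta>\<close>. For a further iterated action \<open>U\<close>, a multilinear \<open>f : U F X \<rightarrow> Y\<close>
  extends to \<open>U T F X \<rightarrow> T U F X \<rightarrow> T Y \<rightarrow> Y\<close>, which coequalizes the image of the pair under \<open>U\<close>
  and hence factors through \<open>U q\<close>. Universality of an isomorphism of the base holds because
  substituting it is precomposition with an isomorphism of iterated actions that is natural and
  commutes with the lax structures.
\<close>

section \<open>Linear categories\<close>

lemma Hom_iff: "f \<in> Hom C A B \<longleftrightarrow> f \<in> Arr C \<and> Dom C f = A \<and> Cod C f = B"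
  by (auto simp: Hom_def)

context linear_category
begin

lemma dom_obj [simp]: "f \<in> Arr C \<Longrightarrow> Dom C f \<in> Obj C"
  and cod_obj [simp]: "f \<in> Arr C \<Longrightarrow> Cod C f \<in> Obj C"
  using arr_dom_cod by auto

text \<open>Typing is split into facts about \<open>Arr\<close>, \<open>Dom\<close> and
  \<open>Cod\<close>, which the simplifier can apply without guessing the intermediate object that
  membership in \<open>Hom\<close> would require.\<close>

lemma ide_arr [simp]:
  assumes "A \<in> Obj C"
  shows "Ide C A \<in> Arr C" "Dom C (Ide C A) = A" "Cod C (Ide C A) = A"
  using ide_hom[OF assms] by (auto simp: Hom_iff)

lemma cmp_arr [simp]:
  assumes "f \<in> Arr C" "g \<in> Arr C" "Dom C g = Cod C f"
  shows "g \<cdot> f \<in> Arr C" "Dom C (g \<cdot> f) = Dom C f" "Cod C (g \<cdot> f) = Cod C g"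
  using cmp_hom[of f "Dom C f" "Cod C f" g "Cod C g"] assms by (auto simp: Hom_iff)

lemma cmp_ide_arr [simp]: "f \<in> Arr C \<Longrightarrow> Dom C f = A \<Longrightarrow> f \<cdot> Ide C A = f"
  and ide_cmp_arr [simp]: "f \<in> Arr C \<Longrightarrow> Cod C f = A \<Longrightarrow> Ide C A \<cdot> f = f"
  using cmp_ide ide_cmp by (auto simp: Hom_iff)

lemma cmp_assoc_arr [simp]:
  "f \<in> Arr C \<Longrightarrow> g \<in> Arr C \<Longrightarrow> h \<in> Arr C \<Longrightarrow> Dom C g = Cod C f \<Longrightarrow> Dom C h = Cod C g
    \<Longrightarrow> (h \<cdot> g) \<cdot> f = h \<cdot> (g \<cdot> f)"
  by (rule cmp_assoc) (auto simp: Hom_iff)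

text \<open>Since \<open>cmp_assoc_arr\<close> nests composites to the right, the left-hand side of
  a known equation for \<open>a \<cdot> b\<close> no longer occurs as a subterm of
  \<open>a \<cdot> (b \<cdot> x)\<close>. This form applies the equation there.\<close>

lemma cmp_eq_cmp:
  "a \<cdot> b = c \<Longrightarrow> x \<in> Arr C \<Longrightarrow> b \<in> Arr C \<Longrightarrow> a \<in> Arr C \<Longrightarrow> Dom C b = Cod C x \<Longrightarrow> Dom C a = Cod C b
    \<Longrightarrow> a \<cdot> (b \<cdot> x) = c \<cdot> x"
  by (metis cmp_assoc_arr)

lemma hzero_hom: "A \<in> Obj C \<Longrightarrow> B \<in> Obj C \<Longrightarrow> HZero C A B \<in> Hom C A B"
proof -
  assume "A \<in> Obj C" "B \<in> Obj C"
  then interpret H: module K "Defs.hom_module C A B"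
    by (rule hom_module)
  show ?thesis
    using H.zero_closed by (simp add: hom_module_def)
qed

lemma hadd_zero_left:
  assumes f: "f \<in> Hom C A B"
  shows "HAdd C (HZero C A B) f = f"
proof -
  interpret H: module K "Defs.hom_module C A B"
    using f by (intro hom_module) (auto simp: Hom_iff)
  show ?thesis
    using H.l_zero[of f] f by (simp add: hom_module_def)
qed

context
  fixes f g A B
  assumes f: "f \<in> Hom C A B" and g: "g \<in> Hom C A B"
begin

interpretation H: module K "Defs.hom_module C A B"
  using f by (intro hom_module) (auto simp: Hom_iff)

lemma hadd_hom: "HAdd C f g \<in> Hom C A B"
  using H.a_closed[of f g] f g by (simp add: hom_module_def)

lemma hadd_cancel_right:
  assumes "h \<in> Hom C A B" "HAdd C f h = HAdd C g h"
  shows "f = g"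
  using H.add.right_cancel[of h f g] f g assms by (simp add: hom_module_def)

text \<open>The record has no subtraction; \<open>d\<close> is \<open>f - g\<close> in the
  hom-group, characterized by addition alone.\<close>

lemma ex_difference: "\<exists>d \<in> Hom C A B. HAdd C d g = f"
proof -
  let ?H = "Defs.hom_module C A B"
  have fg: "f \<in> carrier ?H" "g \<in> carrier ?H"
    using f g by (simp_all add: hom_module_def)
  then have "f \<ominus>\<^bsub>?H\<^esub> g \<oplus>\<^bsub>?H\<^esub> g = f" "f \<ominus>\<^bsub>?H\<^esub> g \<in> carrier ?H"
    by (simp_all add: a_minus_def H.a_assoc H.l_neg)
  then show ?thesis
    by (auto simp: hom_module_def)
qed

end

lemma hzero_arr [simp]:
  assumes "A \<in> Obj C" "B \<in> Obj C"
  shows "HZero C A B \<in> Arr C" "Dom C (HZero C A B) = A" "Cod C (HZero C A B) = B"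
  using hzero_hom[OF assms] by (auto simp: Hom_iff)

text \<open>Cancel \<open>f\<close> from \<open>f + f = 0 + f\<close>. Additive operations preserve
  the equation \<open>0 + 0 = 0\<close>, so this criterion shows that they preserve zero
  arrows.\<close>

lemma idem_hzero: "f \<in> Hom C A B \<Longrightarrow> HAdd C f f = f \<Longrightarrow> f = HZero C A B"
  using hadd_cancel_right[of f A B "HZero C A B" f] hadd_zero_left[of f A B] hzero_hom[of A B]
  by (auto simp: Hom_iff)

lemma cmp_hzero [simp]:
  assumes "f \<in> Arr C" "Dom C f = B" "A \<in> Obj C"
  shows "f \<cdot> HZero C A B = HZero C A (Cod C f)"
proof (rule idem_hzero)
  have B: "B \<in> Obj C"
    using assms by auto
  show "f \<cdot> HZero C A B \<in> Hom C A (Cod C f)"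
    using assms B by (simp add: Hom_iff)
  show "HAdd C (f \<cdot> HZero C A B) (f \<cdot> HZero C A B) = f \<cdot> HZero C A B"
    using cmp_add[of "HZero C A B" A B "HZero C A B" f "Cod C f"] assms B
      hadd_zero_left[OF hzero_hom[of A B]] hzero_hom[of A B]
    by (simp add: Hom_iff)
qed

lemma hzero_cmp [simp]:
  assumes "f \<in> Arr C" "Cod C f = A" "B \<in> Obj C"
  shows "HZero C A B \<cdot> f = HZero C (Dom C f) B"
proof (rule idem_hzero)
  have A: "A \<in> Obj C"
    using assms by auto
  show "HZero C A B \<cdot> f \<in> Hom C (Dom C f) B"
    using assms A by (simp add: Hom_iff)
  show "HAdd C (HZero C A B \<cdot> f) (HZero C A B \<cdot> f) = HZero C A B \<cdot> f"
    using add_cmp[of f "Dom C f" A "HZero C A B" B "HZero C A B"] assms A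
      hadd_zero_left[OF hzero_hom[of A B]] hzero_hom[of A B]
    by (simp add: Hom_iff)
qed

lemma inverse_arrows_arr:
  assumes "inverse_arrows C f g"
  shows "f \<in> Arr C" "g \<in> Arr C" "Dom C g = Cod C f" "Cod C g = Dom C f"
    "g \<cdot> f = Ide C (Dom C f)" "f \<cdot> g = Ide C (Cod C f)"
  using assms by (auto simp: inverse_arrows_def Hom_iff)

lemma inverse_arrowsI:
  "f \<in> Arr C \<Longrightarrow> g \<in> Arr C \<Longrightarrow> Dom C g = Cod C f \<Longrightarrow> Cod C g = Dom C f
    \<Longrightarrow> g \<cdot> f = Ide C (Dom C f) \<Longrightarrow> f \<cdot> g = Ide C (Cod C f) \<Longrightarrow> inverse_arrows C f g"
  by (simp add: inverse_arrows_def Hom_iff)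

lemma inverse_arrows_sym: "inverse_arrows C f g \<Longrightarrow> inverse_arrows C g f"
  by (auto simp: inverse_arrows_def Hom_iff)

lemma inverse_arrows_unique:
  assumes "inverse_arrows C f g" "inverse_arrows C f h"
  shows "g = h"
proof -
  note [simp] = inverse_arrows_arr(1-4)[OF assms(1)] inverse_arrows_arr(1-4)[OF assms(2)]
  have "g \<cdot> (f \<cdot> h) = h"
    by (simp add: cmp_eq_cmp[OF inverse_arrows_arr(5)[OF assms(1)]])
  then show ?thesis
    by (simp add: inverse_arrows_arr(6)[OF assms(2)])
qed

lemma inverse_arrows_inverse_arrow: "is_iso C f \<Longrightarrow> inverse_arrows C f (inverse_arrow C f)"
  unfolding is_iso_def inverse_arrow_def by (metis inverse_arrows_unique theI)

lemma inverse_arrows_ide: "A \<in> Obj C \<Longrightarrow> inverse_arrows C (Ide C A) (Ide C A)"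
  by (rule inverse_arrowsI) auto

lemma inverse_arrows_cmp:
  assumes "inverse_arrows C f f'" "inverse_arrows C g g'" "Dom C g = Cod C f"
  shows "inverse_arrows C (g \<cdot> f) (f' \<cdot> g')"
proof -
  note [simp] = inverse_arrows_arr[OF assms(1)] inverse_arrows_arr[OF assms(2)] assms(3)
  show ?thesis
    by (rule inverse_arrowsI)
      (auto simp: cmp_eq_cmp[OF inverse_arrows_arr(5)[OF assms(2)]]
        cmp_eq_cmp[OF inverse_arrows_arr(6)[OF assms(1)]])
qed

text \<open>Reverses two opposite invertible sides of a commutative square. It carries naturality of
  \<open>spread\<close> and its compatibility with the lax structure over to the inverse of
  \<open>spread\<close>.\<close>

lemma inverse_arrows_square:
  assumes "inverse_arrows C p p'" "inverse_arrows C q q'" and sq: "q \<cdot> g = h \<cdot> p"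
    and [simp]: "g \<in> Arr C" "h \<in> Arr C" "Dom C g = Dom C p" "Cod C g = Dom C q"
      "Dom C h = Cod C p" "Cod C h = Cod C q"
  shows "g \<cdot> p' = q' \<cdot> h"
proof -
  note [simp] = inverse_arrows_arr(1-4)[OF assms(1)] inverse_arrows_arr(1-4)[OF assms(2)]
  have "g \<cdot> p' = q' \<cdot> (q \<cdot> (g \<cdot> p'))"
    by (simp add: cmp_eq_cmp[OF inverse_arrows_arr(5)[OF assms(2)]])
  also have "\<dots> = q' \<cdot> h"
    by (simp add: cmp_eq_cmp[OF sq] inverse_arrows_arr(6)[OF assms(1)])
  finally show ?thesis .
qed

section \<open>Epimorphisms, monomorphisms, kernels and cokernels\<close>

lemma is_epiI:
  assumes "f \<in> Arr C"
    and "\<And>X g h. g \<in> Hom C (Cod C f) X \<Longrightarrow> h \<in> Hom C (Cod C f) X \<Longrightarrow> g \<cdot> f = h \<cdot> f \<Longrightarrow> g = h"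
  shows "is_epi C f"
  using assms by (auto simp: is_epi_def)

lemma is_epi_cancel:
  "is_epi C f \<Longrightarrow> g \<cdot> f = h \<cdot> f \<Longrightarrow> g \<in> Hom C (Cod C f) X \<Longrightarrow> h \<in> Hom C (Cod C f) X \<Longrightarrow> g = h"
  by (auto simp: is_epi_def)

lemma is_epi_cancel_arr:
  "is_epi C f \<Longrightarrow> g \<cdot> f = h \<cdot> f \<Longrightarrow> g \<in> Arr C \<Longrightarrow> h \<in> Arr C
    \<Longrightarrow> Dom C g = Cod C f \<Longrightarrow> Dom C h = Cod C f \<Longrightarrow> Cod C g = Cod C h \<Longrightarrow> g = h"
  by (rule is_epi_cancel[where X = "Cod C h"]) (auto simp: Hom_iff)

text \<open>Two arrows that agree after \<open>f\<close> have a difference that vanishes after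
  \<open>f\<close>.\<close>

lemma is_epi_if_cancel_zero:
  assumes f: "f \<in> Arr C"
    and zero: "\<And>X g. g \<in> Hom C (Cod C f) X \<Longrightarrow> g \<cdot> f = HZero C (Dom C f) X
      \<Longrightarrow> g = HZero C (Cod C f) X"
  shows "is_epi C f"
proof (rule is_epiI)
  fix X g h
  assume g: "g \<in> Hom C (Cod C f) X" and h: "h \<in> Hom C (Cod C f) X" and eq: "g \<cdot> f = h \<cdot> f"
  obtain d where d: "d \<in> Hom C (Cod C f) X" "HAdd C d h = g"
    using ex_difference[OF g h] by blast
  have f': "f \<in> Hom C (Dom C f) (Cod C f)"
    using f by (simp add: Hom_iff)
  have "HAdd C (d \<cdot> f) (h \<cdot> f) = HAdd C (HZero C (Dom C f) X) (h \<cdot> f)"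
    using add_cmp[OF f' d(1) h] d(2) eq hadd_zero_left[OF cmp_hom[OF f' h]] by simp
  then have "d \<cdot> f = HZero C (Dom C f) X"
    using hadd_cancel_right[OF cmp_hom[OF f' d(1)] hzero_hom cmp_hom[OF f' h]] f h
    by (auto simp: Hom_iff)
  then have "d = HZero C (Cod C f) X"
    using zero d(1) by blast
  then show "g = h"
    using d(2) hadd_zero_left[OF h] by simp
qed (rule f)

lemma is_cokernel_arr:
  "is_cokernel C q h \<Longrightarrow> q \<in> Arr C"
  "is_cokernel C q h \<Longrightarrow> h \<in> Arr C"
  "is_cokernel C q h \<Longrightarrow> Dom C q = Cod C h"
  "is_cokernel C q h \<Longrightarrow> q \<cdot> h = HZero C (Dom C h) (Cod C q)"
  by (auto simp: is_cokernel_def)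

lemma is_cokernel_factor:
  assumes "is_cokernel C q h" "x \<in> Arr C" "Dom C x = Cod C h"
    "x \<cdot> h = HZero C (Dom C h) (Cod C x)"
  obtains u where "u \<in> Arr C" "Dom C u = Cod C q" "Cod C u = Cod C x" "u \<cdot> q = x"
proof -
  have "\<exists>!u. u \<in> Hom C (Cod C q) (Cod C x) \<and> u \<cdot> q = x"
    using assms unfolding is_cokernel_def by (simp add: Hom_iff)
  then show thesis
    using that by (auto simp: Hom_iff)
qed

lemma is_cokernel_epi:
  assumes q: "is_cokernel C q h"
  shows "is_epi C q"
proof (rule is_epiI)
  fix X g g'
  assume *: "g \<in> Hom C (Cod C q) X" "g' \<in> Hom C (Cod C q) X" "g \<cdot> q = g' \<cdot> q"
  note qh = is_cokernel_arr[OF q]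
  have "(g \<cdot> q) \<cdot> h = HZero C (Dom C h) X"
    using * qh by (auto simp: Hom_iff)
  moreover have "g \<cdot> q \<in> Hom C (Cod C h) X"
    using * qh by (auto simp: Hom_iff)
  ultimately have "\<exists>!u. u \<in> Hom C (Cod C q) X \<and> u \<cdot> q = g \<cdot> q"
    using q unfolding is_cokernel_def by blast
  then show "g = g'"
    using * by metis
qed (rule is_cokernel_arr(1)[OF q])

text \<open>Uniqueness of the factorization is the epi property of \<open>q\<close>, so only
  existence has to be supplied.\<close>

lemma is_cokernelI:
  assumes q: "is_epi C q" and h: "h \<in> Arr C" and [simp]: "Dom C q = Cod C h"
    and "q \<cdot> h = HZero C (Dom C h) (Cod C q)"
    and ex: "\<And>x. x \<in> Arr C \<Longrightarrow> Dom C x = Cod C h \<Longrightarrow> x \<cdot> h = HZero C (Dom C h) (Cod C x)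
      \<Longrightarrow> \<exists>u. u \<in> Hom C (Cod C q) (Cod C x) \<and> u \<cdot> q = x"
  shows "is_cokernel C q h"
  unfolding is_cokernel_def
proof (intro conjI allI ballI impI ex_ex1I)
  fix X x
  assume "x \<in> Hom C (Cod C h) X" "x \<cdot> h = HZero C (Dom C h) X"
  then show "\<exists>u. u \<in> Hom C (Cod C q) X \<and> u \<cdot> q = x"
    using ex by (auto simp: Hom_iff)
qed (use assms in \<open>auto simp: is_epi_def\<close>)

lemma is_kernel_arr:
  "is_kernel C k f \<Longrightarrow> k \<in> Arr C"
  "is_kernel C k f \<Longrightarrow> f \<in> Arr C"
  "is_kernel C k f \<Longrightarrow> Cod C k = Dom C f"
  "is_kernel C k f \<Longrightarrow> f \<cdot> k = HZero C (Dom C k) (Cod C f)"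
  by (auto simp: is_kernel_def)

lemma is_kernel_factor:
  assumes "is_kernel C k f" "x \<in> Arr C" "Cod C x = Dom C f"
    "f \<cdot> x = HZero C (Dom C x) (Cod C f)"
  obtains u where "u \<in> Arr C" "Dom C u = Dom C x" "Cod C u = Dom C k" "k \<cdot> u = x"
proof -
  have "\<exists>!u. u \<in> Hom C (Dom C x) (Dom C k) \<and> k \<cdot> u = x"
    using assms unfolding is_kernel_def by (simp add: Hom_iff)
  then show thesis
    using that by (auto simp: Hom_iff)
qed

lemma is_kernel_mono:
  assumes k: "is_kernel C k f"
  shows "is_mono C k"
  unfolding is_mono_def
proof (intro conjI allI ballI impI)
  fix X g g'
  assume *: "g \<in> Hom C X (Dom C k)" "g' \<in> Hom C X (Dom C k)" "k \<cdot> g = k \<cdot> g'"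
  note kf = is_kernel_arr[OF k]
  have "f \<cdot> (k \<cdot> g) = HZero C X (Cod C f)"
    using * kf(1-3) by (auto simp: Hom_iff cmp_eq_cmp[OF kf(4)])
  moreover have "k \<cdot> g \<in> Hom C X (Dom C f)"
    using * kf by (auto simp: Hom_iff)
  ultimately have "\<exists>!u. u \<in> Hom C X (Dom C k) \<and> k \<cdot> u = k \<cdot> g"
    using k unfolding is_kernel_def by blast
  then show "g = g'"
    using * by metis
qed (rule is_kernel_arr(1)[OF k])

lemma is_mono_cancel_arr:
  "is_mono C f \<Longrightarrow> f \<cdot> g = f \<cdot> h \<Longrightarrow> g \<in> Arr C \<Longrightarrow> h \<in> Arr C
    \<Longrightarrow> Cod C g = Dom C f \<Longrightarrow> Cod C h = Dom C f \<Longrightarrow> Dom C g = Dom C h \<Longrightarrow> g = h"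
  by (auto simp: is_mono_def Hom_iff)

lemma is_mono_cmp:
  assumes "is_mono C f" "is_mono C g" "Dom C g = Cod C f"
  shows "is_mono C (g \<cdot> f)"
proof -
  have arr: "f \<in> Arr C" "g \<in> Arr C"
    using assms by (auto simp: is_mono_def)
  show ?thesis
    unfolding is_mono_def
  proof (intro conjI allI ballI impI)
    fix X x y
    assume *: "x \<in> Hom C X (Dom C (g \<cdot> f))" "y \<in> Hom C X (Dom C (g \<cdot> f))"
      "(g \<cdot> f) \<cdot> x = (g \<cdot> f) \<cdot> y"
    then have "g \<cdot> (f \<cdot> x) = g \<cdot> (f \<cdot> y)" and "f \<cdot> x \<in> Hom C X (Dom C g)" "f \<cdot> y \<in> Hom C X (Dom C g)"
      using arr assms(3) by (auto simp: Hom_iff)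
    then have "f \<cdot> x = f \<cdot> y"
      using assms(2) unfolding is_mono_def by blast
    then show "x = y"
      using assms(1,3) * arr unfolding is_mono_def by auto
  qed (use arr assms in auto)
qed

text \<open>An arrow that kills \<open>i \<cdot> e\<close> already kills \<open>i\<close>, because
  \<open>e\<close> is epi; so both have the same arrows to factor.\<close>

lemma is_cokernel_cmp_epi:
  assumes q: "is_cokernel C q i" and e: "is_epi C e" and [simp]: "Dom C i = Cod C e"
  shows "is_cokernel C q (i \<cdot> e)"
proof -
  note [simp] = is_cokernel_arr[OF q]
  have [simp]: "e \<in> Arr C"
    using e by (simp add: is_epi_def)
  have qie: "q \<cdot> (i \<cdot> e) = HZero C (Dom C e) (Cod C q)"
    by (simp add: cmp_eq_cmp[OF is_cokernel_arr(4)[OF q]])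
  show ?thesis
  proof (rule is_cokernelI)
    fix x
    assume x: "x \<in> Arr C" "Dom C x = Cod C (i \<cdot> e)"
      and "x \<cdot> (i \<cdot> e) = HZero C (Dom C (i \<cdot> e)) (Cod C x)"
    then have "(x \<cdot> i) \<cdot> e = HZero C (Cod C e) (Cod C x) \<cdot> e"
      by auto
    then have "x \<cdot> i = HZero C (Cod C e) (Cod C x)"
      by (rule is_epi_cancel_arr[OF e]) (use x in auto)
    then show "\<exists>u. u \<in> Hom C (Cod C q) (Cod C x) \<and> u \<cdot> q = x"
      using is_cokernel_factor[OF q, of x] x by (auto simp: Hom_iff)
  qed (use is_cokernel_epi[OF q] qie in auto)
qed

end

section \<open>Coequalizers, reduced to cokernels of differences\<close>

definition is_coequalizer :: "('k, 'o, 'a, 'e) lincat_scheme \<Rightarrow> 'a \<Rightarrow> 'a \<Rightarrow> 'a \<Rightarrow> bool" where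
  "is_coequalizer C q f g \<longleftrightarrow> f \<in> Arr C \<and> g \<in> Hom C (Dom C f) (Cod C f) \<and>
     q \<in> Arr C \<and> Dom C q = Cod C f \<and> q \<cdot>\<^bsub>C\<^esub> f = q \<cdot>\<^bsub>C\<^esub> g \<and>
     (\<forall>X. \<forall>h \<in> Hom C (Cod C f) X. h \<cdot>\<^bsub>C\<^esub> f = h \<cdot>\<^bsub>C\<^esub> g \<longrightarrow>
        (\<exists>!u. u \<in> Hom C (Cod C q) X \<and> u \<cdot>\<^bsub>C\<^esub> q = h))"

text \<open>Formulated for a bare map on arrows, so that it composes along a list of actions without
  any functor laws.\<close>

definition preserves_coequalizers :: "('k, 'o, 'a, 'e) lincat_scheme
    \<Rightarrow> ('k, 'p, 'b, 'd) lincat_scheme \<Rightarrow> ('a \<Rightarrow> 'b) \<Rightarrow> bool" where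
  "preserves_coequalizers C D Fa \<longleftrightarrow>
     (\<forall>q f g. is_coequalizer C q f g \<longrightarrow> is_coequalizer D (Fa q) (Fa f) (Fa g))"

context linear_category
begin

text \<open>Since \<open>h \<cdot> f\<close> is the sum of \<open>h \<cdot> d\<close> and
  \<open>h \<cdot> g\<close>, cancellation of \<open>h \<cdot> g\<close> gives the
  equivalence.\<close>

lemma cmp_difference_zero_iff:
  assumes "d \<in> Hom C A B" "g \<in> Hom C A B" "HAdd C d g = f" "h \<in> Hom C B X"
  shows "h \<cdot> d = HZero C A X \<longleftrightarrow> h \<cdot> f = h \<cdot> g"
proof -
  have zero: "HZero C A X \<in> Hom C A X"
    using assms by (intro hzero_hom) (auto simp: Hom_iff)
  have "h \<cdot> f = HAdd C (h \<cdot> d) (h \<cdot> g)"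
    using cmp_add[OF assms(1,2,4)] assms(3) by simp
  moreover have "HAdd C (HZero C A X) (h \<cdot> g) = h \<cdot> g"
    using assms cmp_hom by (intro hadd_zero_left) blast
  ultimately show ?thesis
    using hadd_cancel_right[OF cmp_hom[OF assms(1,4)] zero cmp_hom[OF assms(2,4)]] by metis
qed

text \<open>The arrows that kill the difference \<open>d\<close> are those that coequalize
  \<open>f\<close> and \<open>g\<close>, so both universal properties range over the same
  arrows.\<close>

lemma is_coequalizer_iff_is_cokernel:
  assumes d: "d \<in> Hom C A B" and g: "g \<in> Hom C A B" and f: "HAdd C d g = f"
  shows "is_coequalizer C q f g \<longleftrightarrow> is_cokernel C q d"
proof -
  have "f \<in> Hom C A B"
    using hadd_hom[OF d g] f by simp
  then have [simp]: "d \<in> Arr C" "Dom C d = A" "Cod C d = B" "f \<in> Arr C" "Dom C f = A" "Cod C f = B"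
    using d by (auto simp: Hom_iff)
  have iff: "h \<cdot> d = HZero C A X \<longleftrightarrow> h \<cdot> f = h \<cdot> g" if "h \<in> Hom C B X" for h X
    using cmp_difference_zero_iff[OF d g f that] .
  have "q \<cdot> d = HZero C A (Cod C q) \<longleftrightarrow> q \<cdot> f = q \<cdot> g" if "q \<in> Arr C" "Dom C q = B"
    using iff[of q "Cod C q"] that by (simp add: Hom_iff)
  \<comment> \<open>Hiding the unique factorization behind \<open>P\<close> leaves two formulas that
    differ only in the conditions already shown equivalent.\<close>
  moreover define P where "P X h \<longleftrightarrow> (\<exists>!u. u \<in> Hom C (Cod C q) X \<and> u \<cdot> q = h)" for X h
  have "(\<forall>X. \<forall>h \<in> Hom C B X. h \<cdot> d = HZero C A X \<longrightarrow> P X h) \<longleftrightarrow>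
      (\<forall>X. \<forall>h \<in> Hom C B X. h \<cdot> f = h \<cdot> g \<longrightarrow> P X h)"
    using iff by blast
  moreover have "is_cokernel C q d \<longleftrightarrow> q \<in> Arr C \<and> Dom C q = B \<and> q \<cdot> d = HZero C A (Cod C q) \<and>
      (\<forall>X. \<forall>h \<in> Hom C B X. h \<cdot> d = HZero C A X \<longrightarrow> P X h)"
    by (simp add: is_cokernel_def P_def)
  moreover have "is_coequalizer C q f g \<longleftrightarrow> q \<in> Arr C \<and> Dom C q = B \<and> q \<cdot> f = q \<cdot> g \<and>
      (\<forall>X. \<forall>h \<in> Hom C B X. h \<cdot> f = h \<cdot> g \<longrightarrow> P X h)"
    using g by (simp add: is_coequalizer_def P_def)
  ultimately show ?thesis
    by blast
qed

lemma is_coequalizer_arr: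
  assumes "is_coequalizer C q f g"
  shows "f \<in> Arr C" "g \<in> Arr C" "q \<in> Arr C" "Dom C g = Dom C f" "Cod C g = Cod C f"
    "Dom C q = Cod C f" "q \<cdot> f = q \<cdot> g"
  using assms by (auto simp: is_coequalizer_def Hom_iff)

lemma is_coequalizer_factor:
  assumes "is_coequalizer C q f g" "x \<in> Arr C" "Dom C x = Cod C f" "x \<cdot> f = x \<cdot> g"
  obtains u where "u \<in> Arr C" "Dom C u = Cod C q" "Cod C u = Cod C x" "u \<cdot> q = x"
proof -
  have "\<exists>!u. u \<in> Hom C (Cod C q) (Cod C x) \<and> u \<cdot> q = x"
    using assms unfolding is_coequalizer_def by (simp add: Hom_iff)
  then show thesis
    using that by (auto simp: Hom_iff)
qed

lemma is_coequalizer_epi: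
  assumes "is_coequalizer C q f g"
  shows "is_epi C q"
proof -
  note * = is_coequalizer_arr[OF assms]
  obtain d where d: "d \<in> Hom C (Dom C f) (Cod C f)" "HAdd C d g = f"
    using ex_difference[of f "Dom C f" "Cod C f" g] * by (auto simp: Hom_iff)
  then have "is_cokernel C q d"
    using is_coequalizer_iff_is_cokernel[of d "Dom C f" "Cod C f" g f q] assms * by (auto simp: Hom_iff)
  then show ?thesis
    by (rule is_cokernel_epi)
qed

end

section \<open>Images in abelian categories\<close>

context abelian_category
begin

lemma ex_coequalizer:
  assumes "f \<in> Hom C A B" "g \<in> Hom C A B"
  shows "\<exists>q. is_coequalizer C q f g"
proof -
  obtain d where d: "d \<in> Hom C A B" "HAdd C d g = f"
    using ex_difference[OF assms] by blast
  then obtain q where "is_cokernel C q d"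
    using ex_cokernel by (auto simp: Hom_iff)
  then show ?thesis
    using is_coequalizer_iff_is_cokernel[OF d(1) assms(2) d(2)] by blast
qed

text \<open>The epi \<open>e\<close> is a cokernel of some \<open>g\<close>, and \<open>g\<close>
  factors through the kernel \<open>k\<close>. Hence an arrow that kills \<open>k\<close> kills
  \<open>g\<close> and factors through \<open>e\<close>.\<close>

lemma is_cokernel_of_kernel:
  assumes e: "is_epi C e" and k: "is_kernel C k e"
  shows "is_cokernel C e k"
proof -
  note [simp] = is_kernel_arr[OF k]
  obtain g where g: "is_cokernel C e g"
    using epi_is_cokernel[OF e] by blast
  note [simp] = is_cokernel_arr[OF g]
  obtain s where s [simp]: "s \<in> Arr C" "Dom C s = Dom C g" "Cod C s = Dom C k" "k \<cdot> s = g"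
    using is_kernel_factor[OF k, of g] by auto
  show ?thesis
  proof (rule is_cokernelI[OF e])
    fix x
    assume x [simp]: "x \<in> Arr C" "Dom C x = Cod C k"
      and zero: "x \<cdot> k = HZero C (Dom C k) (Cod C x)"
    have "x \<cdot> (k \<cdot> s) = HZero C (Dom C g) (Cod C x)"
      by (subst cmp_eq_cmp[OF zero]) (auto simp del: s(4))
    then show "\<exists>u. u \<in> Hom C (Cod C e) (Cod C x) \<and> u \<cdot> e = x"
      using is_cokernel_factor[OF g, of x] by (auto simp: Hom_iff)
  qed auto
qed

text \<open>Here \<open>i\<close> is the image of \<open>h\<close>. That \<open>q\<close> is also a
  cokernel of \<open>i\<close> is clear, since an arrow killing \<open>i\<close> kills
  \<open>h\<close>. The work lies in showing that \<open>e\<close> is epi: its own image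
  \<open>m\<close> gives a subobject \<open>i \<cdot> m\<close> through which \<open>h\<close>
  factors, and minimality of the image makes \<open>m\<close> split epi, so the cokernel of
  \<open>e\<close> vanishes.\<close>

lemma image_factorization:
  assumes q: "is_cokernel C q h"
  obtains i e where "is_kernel C i q" "is_cokernel C q i" "is_epi C e" "Dom C i = Cod C e" "i \<cdot> e = h"
proof -
  note [simp] = is_cokernel_arr[OF q]
  obtain i where i: "is_kernel C i q"
    using ex_kernel[of q] by auto
  note [simp] = is_kernel_arr[OF i]
  obtain e where e [simp]: "e \<in> Arr C" "Dom C e = Dom C h" "Cod C e = Dom C i" and ie: "i \<cdot> e = h"
    using is_kernel_factor[OF i, of h] by auto
  have "is_epi C e"
  proof (rule is_epi_if_cancel_zero)
    fix X g
    assume g: "g \<in> Hom C (Cod C e) X" "g \<cdot> e = HZero C (Dom C e) X"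
    obtain c where c: "is_cokernel C c e"
      using ex_cokernel[of e] by auto
    note [simp] = is_cokernel_arr[OF c]
    obtain m where m: "is_kernel C m c"
      using ex_kernel[of c] by auto
    note [simp] = is_kernel_arr[OF m]
    obtain e' where e' [simp]: "e' \<in> Arr C" "Dom C e' = Dom C e" "Cod C e' = Dom C m" and me': "m \<cdot> e' = e"
      using is_kernel_factor[OF m, of e] by auto
    \<comment> \<open>Minimality is derived from the fact that this mono is the kernel of some
      \<open>t\<close>: then \<open>t\<close> kills \<open>h\<close>, factors through
      \<open>q\<close>, and therefore kills \<open>i\<close>.\<close>
    have "is_mono C (i \<cdot> m)"
      by (rule is_mono_cmp) (use i m is_kernel_mono in auto)
    then obtain t where t: "is_kernel C (i \<cdot> m) t"
      using mono_is_kernel by blast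
    have [simp]: "t \<in> Arr C" "Dom C t = Cod C i" and tim: "t \<cdot> (i \<cdot> m) = HZero C (Dom C m) (Cod C t)"
      using is_kernel_arr[OF t] by auto
    have "t \<cdot> h = (t \<cdot> (i \<cdot> m)) \<cdot> e'"
      by (simp add: me' ie)
    also have "\<dots> = HZero C (Dom C h) (Cod C t)"
      unfolding tim by simp
    finally obtain t' where t' [simp]: "t' \<in> Arr C" "Dom C t' = Cod C q" "Cod C t' = Cod C t" "t' \<cdot> q = t"
      using is_cokernel_factor[OF q, of t] by auto
    have "t' \<cdot> (q \<cdot> i) = t \<cdot> i"
      by (subst cmp_eq_cmp[OF t'(4)]) auto
    then have "t \<cdot> i = HZero C (Dom C i) (Cod C t)"
      by simp
    then obtain s where s [simp]: "s \<in> Arr C" "Dom C s = Dom C i" "Cod C s = Dom C m" and ims: "(i \<cdot> m) \<cdot> s = i"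
      using is_kernel_factor[OF t, of i] by auto
    \<comment> \<open>The right inverse \<open>s\<close> of \<open>m\<close> forces
      \<open>c = 0\<close>, since \<open>c\<close> kills \<open>m\<close>; and \<open>g\<close>
      factors through \<open>c\<close>.\<close>
    have "m \<cdot> s = Ide C (Dom C i)"
      by (rule is_mono_cancel_arr[OF is_kernel_mono[OF i]]) (use ims in auto)
    then have "c = c \<cdot> (m \<cdot> s)"
      by simp
    also have "\<dots> = HZero C (Dom C c) (Cod C c)"
      by (subst cmp_eq_cmp[OF is_kernel_arr(4)[OF m]]) auto
    finally have c0: "c = HZero C (Dom C c) (Cod C c)" .
    obtain u where "u \<in> Arr C" "Dom C u = Cod C c" "Cod C u = X" "u \<cdot> c = g"
      using is_cokernel_factor[OF c, of g] g by (auto simp: Hom_iff)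
    then show "g = HZero C (Cod C e) X"
      using cmp_hzero[of u "Cod C c" "Dom C c"] arg_cong[OF c0, of "\<lambda>c. u \<cdot> c"] by auto
  qed auto
  moreover from this have "is_cokernel C q i"
  proof (intro is_cokernelI is_cokernel_epi[OF q])
    fix x
    assume x: "x \<in> Arr C" "Dom C x = Cod C i" and zero: "x \<cdot> i = HZero C (Dom C i) (Cod C x)"
    have "x \<cdot> (i \<cdot> e) = HZero C (Dom C h) (Cod C x)"
      using x by (subst cmp_eq_cmp[OF zero]) auto
    then show "\<exists>u. u \<in> Hom C (Cod C q) (Cod C x) \<and> u \<cdot> q = x"
      using is_cokernel_factor[OF q, of x] x ie by (auto simp: Hom_iff)
  qed auto
  ultimately show thesis
    using that i ie by auto
qed

end

section \<open>Right exact functors\<close>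

context linear_functor
begin

declare fun_obj [simp]

lemma fun_arr [simp]:
  assumes "f \<in> Arr C"
  shows "Fa f \<in> Arr D" "Dom D (Fa f) = Fo (Dom C f)" "Cod D (Fa f) = Fo (Cod C f)"
  using fun_hom[of f "Dom C f" "Cod C f"] assms by (auto simp: Hom_iff)

lemma fun_cmp_arr:
  "f \<in> Arr C \<Longrightarrow> g \<in> Arr C \<Longrightarrow> Dom C g = Cod C f \<Longrightarrow> Fa (g \<cdot>\<^bsub>C\<^esub> f) = Fa g \<cdot>\<^bsub>D\<^esub> Fa f"
  by (rule fun_cmp) (auto simp: Hom_iff)

lemma fun_inverse_arrows:
  assumes "inverse_arrows C f g"
  shows "inverse_arrows D (Fa f) (Fa g)"
proof -
  note [simp] = C.inverse_arrows_arr[OF assms]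
  show ?thesis
    by (rule D.inverse_arrowsI) (auto simp: fun_ide simp flip: fun_cmp_arr)
qed

lemma fun_hzero:
  assumes "A \<in> Obj C" "B \<in> Obj C"
  shows "Fa (HZero C A B) = HZero D (Fo A) (Fo B)"
proof (rule D.idem_hzero)
  have z: "HZero C A B \<in> Hom C A B"
    using assms by (rule C.hzero_hom)
  show "Fa (HZero C A B) \<in> Hom D (Fo A) (Fo B)"
    using z by (rule fun_hom)
  show "HAdd D (Fa (HZero C A B)) (Fa (HZero C A B)) = Fa (HZero C A B)"
    using fun_add[OF z z] C.hadd_zero_left[OF z] by simp
qed

text \<open>A linear functor sends the difference of a pair to the difference of the images, so
  cokernels are enough.\<close>

lemma preserves_coequalizersI:
  assumes pres: "\<And>q h. is_cokernel C q h \<Longrightarrow> is_cokernel D (Fa q) (Fa h)"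
  shows "preserves_coequalizers C D Fa"
  unfolding preserves_coequalizers_def
proof (intro allI impI)
  fix q f g
  assume q: "is_coequalizer C q f g"
  let ?A = "Dom C f" and ?B = "Cod C f"
  have f: "f \<in> Hom C ?A ?B" and g: "g \<in> Hom C ?A ?B"
    using C.is_coequalizer_arr[OF q] by (auto simp: Hom_iff)
  obtain d where d: "d \<in> Hom C ?A ?B" "HAdd C d g = f"
    using C.ex_difference[OF f g] by blast
  have "is_cokernel D (Fa q) (Fa d)"
    using C.is_coequalizer_iff_is_cokernel[OF d(1) g d(2)] q pres by blast
  then show "is_coequalizer D (Fa q) (Fa f) (Fa g)"
    using D.is_coequalizer_iff_is_cokernel[OF fun_hom[OF d(1)] fun_hom[OF g]] fun_add[OF d(1) g] d(2)
    by auto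
qed

end

text \<open>Right exactness speaks of short exact sequences, while \<open>h\<close> is arbitrary.
  Write \<open>h\<close> as an epi \<open>e\<close> followed by the image \<open>i\<close>. The
  short exact sequence of \<open>i\<close> and \<open>q\<close> makes \<open>Fa q\<close> a cokernel
  of \<open>Fa i\<close>, and composing with the epi \<open>Fa e\<close> keeps it a
  cokernel.\<close>

lemma (in right_exact_functor) right_exact_preserves_coequalizers:
  assumes "abelian_category K C" "abelian_category K D"
  shows "preserves_coequalizers C D Fa"
proof (rule preserves_coequalizersI)
  interpret C: abelian_category K C by fact
  interpret D: abelian_category K D by fact
  fix q h
  assume q: "is_cokernel C q h"
  note [simp] = C.is_cokernel_arr[OF q]
  obtain i e where i: "is_kernel C i q" "is_cokernel C q i" and e: "is_epi C e"
    and [simp]: "Dom C i = Cod C e" and ie: "i \<cdot>\<^bsub>C\<^esub> e = h"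
    using C.image_factorization[OF q] by metis
  note [simp] = C.is_kernel_arr[OF i(1)]
  have [simp]: "e \<in> Arr C"
    using e by (simp add: is_epi_def)
  obtain k where k: "is_kernel C k e"
    using C.ex_kernel[of e] by auto
  \<comment> \<open>The short exact sequence of \<open>k\<close> and \<open>e\<close> gives that
    \<open>Fa e\<close> is epi.\<close>
  have "exact_at C k e"
    using C.is_kernel_arr[OF k] C.is_cokernel_of_kernel[OF e k] k
    by (auto simp: exact_at_def is_image_def)
  then have Fe: "is_epi D (Fa e)"
    using right_exact[OF C.is_kernel_mono[OF k] _ e] by blast
  have "exact_at C i q"
    using i by (auto simp: exact_at_def is_image_def)
  then have "exact_at D (Fa i) (Fa q)" and Fq: "is_epi D (Fa q)"
    using right_exact[OF C.is_kernel_mono[OF i(1)] _ C.is_cokernel_epi[OF q]] by auto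
  then obtain j c where c: "is_cokernel D c (Fa i)" and j: "is_kernel D j c" "is_kernel D j (Fa q)"
    by (auto simp: exact_at_def is_image_def)
  note [simp] = D.is_cokernel_arr[OF c] D.is_kernel_arr[OF j(1)] D.is_kernel_arr[OF j(2)]
  have jq: "is_cokernel D (Fa q) j"
    using D.is_cokernel_of_kernel[OF Fq j(2)] .
  have "is_cokernel D (Fa q) (Fa i)"
  proof (rule D.is_cokernelI[OF Fq])
    have "Fa q \<cdot>\<^bsub>D\<^esub> Fa i = Fa (q \<cdot>\<^bsub>C\<^esub> i)"
      by (subst fun_cmp_arr) auto
    then show "Fa q \<cdot>\<^bsub>D\<^esub> Fa i = HZero D (Dom D (Fa i)) (Cod D (Fa q))"
      by (simp add: fun_hzero)
    \<comment> \<open>Exactness in \<open>D\<close> says that the kernel \<open>j\<close> of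
      \<open>Fa q\<close> is the image of \<open>Fa i\<close>. An arrow \<open>x\<close> killing
      \<open>Fa i\<close> factors through the cokernel \<open>c\<close>, so it kills
      \<open>j\<close> and then factors through \<open>Fa q\<close>.\<close>
    fix x
    assume x [simp]: "x \<in> Arr D" "Dom D x = Cod D (Fa i)"
      and zero: "x \<cdot>\<^bsub>D\<^esub> Fa i = HZero D (Dom D (Fa i)) (Cod D x)"
    obtain x' where x' [simp]: "x' \<in> Arr D" "Dom D x' = Cod D c" "Cod D x' = Cod D x" "x' \<cdot>\<^bsub>D\<^esub> c = x"
      using D.is_cokernel_factor[OF c, of x] zero by auto
    have [simp]: "Cod D j = Fo (Cod C i)"
      using D.is_kernel_arr(3)[OF j(2)] by simp
    have "x' \<cdot>\<^bsub>D\<^esub> (c \<cdot>\<^bsub>D\<^esub> j) = x \<cdot>\<^bsub>D\<^esub> j"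
      by (subst D.cmp_eq_cmp[OF x'(4)]) auto
    then have "x \<cdot>\<^bsub>D\<^esub> j = HZero D (Dom D j) (Cod D x)"
      by simp
    then show "\<exists>u. u \<in> Hom D (Cod D (Fa q)) (Cod D x) \<and> u \<cdot>\<^bsub>D\<^esub> Fa q = x"
      using D.is_cokernel_factor[OF jq, of x] by (auto simp: Hom_iff)
  qed auto
  then have "is_cokernel D (Fa q) (Fa i \<cdot>\<^bsub>D\<^esub> Fa e)"
    by (rule D.is_cokernel_cmp_epi[OF _ Fe]) auto
  then show "is_cokernel D (Fa q) (Fa h)"
    using ie by (simp flip: fun_cmp_arr)
qed

section \<open>Construction of the universal target as a coequalizer of free modules\<close>

section \<open>Lax endofunctors of a linear monad\<close>

text \<open>The monad is separated from the monoidal category: in the coequalizer argument an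
  iterated action is just an endofunctor with one natural map into the monad.\<close>

locale linear_monad = M: linear_category K M + linear_functor K M M To Ta
  for K :: "('k, 'r) ring_scheme" and M :: "('k, 'm, 'g, 'd) lincat_scheme" (structure)
    and To :: "'m \<Rightarrow> 'm" and Ta :: "'g \<Rightarrow> 'g" +
  fixes mu :: "'m \<Rightarrow> 'g" and eta :: "'m \<Rightarrow> 'g"
  assumes mu_hom: "X \<in> Obj M \<Longrightarrow> mu X \<in> Hom M (To (To X)) (To X)"
    and mu_natural: "x \<in> Hom M X Y \<Longrightarrow> mu Y \<cdot> Ta (Ta x) = Ta x \<cdot> mu X"
    and eta_hom: "X \<in> Obj M \<Longrightarrow> eta X \<in> Hom M X (To X)"
    and eta_natural: "x \<in> Hom M X Y \<Longrightarrow> eta Y \<cdot> x = Ta x \<cdot> eta X"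
    and mu_assoc: "X \<in> Obj M \<Longrightarrow> mu X \<cdot> Ta (mu X) = mu X \<cdot> mu (To X)"
    and mu_eta_left: "X \<in> Obj M \<Longrightarrow> mu X \<cdot> eta (To X) = Ide M (To X)"
    and mu_eta_right: "X \<in> Obj M \<Longrightarrow> mu X \<cdot> Ta (eta X) = Ide M (To X)"
begin

lemma mu_arr [simp]:
  assumes "X \<in> Obj M"
  shows "mu X \<in> Arr M" "Dom M (mu X) = To (To X)" "Cod M (mu X) = To X"
  using mu_hom[OF assms] by (auto simp: Hom_iff)

lemma eta_arr [simp]:
  assumes "X \<in> Obj M"
  shows "eta X \<in> Arr M" "Dom M (eta X) = X" "Cod M (eta X) = To X"
  using eta_hom[OF assms] by (auto simp: Hom_iff)

text \<open>The second form carries a trailing arrow \<open>r\<close>, for rewriting inside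
  composites nested to the right.\<close>

lemma mu_natural_arr:
  assumes "x \<in> Arr M" "Cod M x = Y"
  shows "mu Y \<cdot> Ta (Ta x) = Ta x \<cdot> mu (Dom M x)"
    and "r \<in> Arr M \<Longrightarrow> Cod M r = To (To (Dom M x))
      \<Longrightarrow> mu Y \<cdot> (Ta (Ta x) \<cdot> r) = Ta x \<cdot> (mu (Dom M x) \<cdot> r)"
proof -
  show *: "mu Y \<cdot> Ta (Ta x) = Ta x \<cdot> mu (Dom M x)"
    using mu_natural[of x "Dom M x" Y] assms by (simp add: Hom_iff)
  show "mu Y \<cdot> (Ta (Ta x) \<cdot> r) = Ta x \<cdot> (mu (Dom M x) \<cdot> r)"
    if "r \<in> Arr M" "Cod M r = To (To (Dom M x))"
    by (subst M.cmp_eq_cmp[OF *]) (use assms that in auto)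
qed

lemma eta_natural_arr:
  "x \<in> Arr M \<Longrightarrow> Cod M x = Y \<Longrightarrow> eta Y \<cdot> x = Ta x \<cdot> eta (Dom M x)"
  using eta_natural[of x "Dom M x" Y] by (simp add: Hom_iff)

text \<open>This is \<open>EM_obj\<close> for a monad given by separate functions instead of a
  record.\<close>

definition algebras :: "('m \<times> 'g) set" where
  "algebras = {(X, a). X \<in> Obj M \<and> a \<in> Hom M (To X) X \<and> a \<cdot> eta X = Ide M X \<and> a \<cdot> mu X = a \<cdot> Ta a}"

lemma algebras_arr:
  assumes "(X, a) \<in> algebras"
  shows "X \<in> Obj M" "a \<in> Arr M" "Dom M a = To X" "Cod M a = X" "a \<cdot> eta X = Ide M X"
    "a \<cdot> Ta a = a \<cdot> mu X"
  using assms by (auto simp: algebras_def Hom_iff)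

end

text \<open>Abstract form of \<open>multilinear\<close>, with an arbitrary endofunctor and structure
  map in place of the iterated action and \<open>lax_list\<close>. Composite endofunctors then fit
  as well.\<close>

definition lax_linear_maps :: "('k, 'm, 'g, 'd) lincat_scheme \<Rightarrow> ('g \<Rightarrow> 'g) \<Rightarrow> ('m \<Rightarrow> 'm)
    \<Rightarrow> ('g \<Rightarrow> 'g) \<Rightarrow> ('m \<Rightarrow> 'g) \<Rightarrow> 'm \<times> 'g \<Rightarrow> 'm \<times> 'g \<Rightarrow> 'g set" where
  "lax_linear_maps M Ta Fo Fa phi X Y = {f \<in> Hom M (Fo (fst X)) (fst Y).
     f \<cdot>\<^bsub>M\<^esub> Fa (snd X) = snd Y \<cdot>\<^bsub>M\<^esub> Ta f \<cdot>\<^bsub>M\<^esub> phi (fst X)}"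

text \<open>These laws extend \<open>F\<close> to the Kleisli category, that is, to free modules.
  Arbitrary modules are reached by presenting them through free ones, which is where a coequalizer
  enters.\<close>

locale lax_endofunctor =
  linear_monad K M To Ta mu eta + F: linear_functor K M M Fo Fa
  for K :: "('k, 'r) ring_scheme" and M :: "('k, 'm, 'g, 'd) lincat_scheme" (structure)
    and To :: "'m \<Rightarrow> 'm" and Ta :: "'g \<Rightarrow> 'g" and mu :: "'m \<Rightarrow> 'g" and eta :: "'m \<Rightarrow> 'g"
    and Fo :: "'m \<Rightarrow> 'm" and Fa :: "'g \<Rightarrow> 'g" +
  fixes phi :: "'m \<Rightarrow> 'g"
  assumes phi_hom: "X \<in> Obj M \<Longrightarrow> phi X \<in> Hom M (Fo (To X)) (To (Fo X))"
    and phi_natural: "x \<in> Hom M X Y \<Longrightarrow> phi Y \<cdot> Fa (Ta x) = Ta (Fa x) \<cdot> phi X"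
    and mu_phi: "X \<in> Obj M \<Longrightarrow> mu (Fo X) \<cdot> Ta (phi X) \<cdot> phi (To X) = phi X \<cdot> Fa (mu X)"
    and phi_eta: "X \<in> Obj M \<Longrightarrow> phi X \<cdot> Fa (eta X) = eta (Fo X)"
begin

lemma phi_arr [simp]:
  assumes "X \<in> Obj M"
  shows "phi X \<in> Arr M" "Dom M (phi X) = Fo (To X)" "Cod M (phi X) = To (Fo X)"
  using phi_hom[OF assms] by (auto simp: Hom_iff)

lemma phi_natural_arr:
  assumes "x \<in> Arr M" "Cod M x = Y"
  shows "phi Y \<cdot> Fa (Ta x) = Ta (Fa x) \<cdot> phi (Dom M x)"
    and "r \<in> Arr M \<Longrightarrow> Cod M r = Fo (To (Dom M x))
      \<Longrightarrow> phi Y \<cdot> (Fa (Ta x) \<cdot> r) = Ta (Fa x) \<cdot> (phi (Dom M x) \<cdot> r)"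
proof -
  show *: "phi Y \<cdot> Fa (Ta x) = Ta (Fa x) \<cdot> phi (Dom M x)"
    using phi_natural[of x "Dom M x" Y] assms by (simp add: Hom_iff)
  show "phi Y \<cdot> (Fa (Ta x) \<cdot> r) = Ta (Fa x) \<cdot> (phi (Dom M x) \<cdot> r)"
    if "r \<in> Arr M" "Cod M r = Fo (To (Dom M x))"
    by (subst M.cmp_eq_cmp[OF *]) (use assms that in auto)
qed

lemma phi_mu:
  assumes [simp]: "X \<in> Obj M"
  shows "phi X \<cdot> Fa (mu X) = mu (Fo X) \<cdot> (Ta (phi X) \<cdot> phi (To X))"
    and "r \<in> Arr M \<Longrightarrow> Cod M r = Fo (To (To X))
      \<Longrightarrow> phi X \<cdot> (Fa (mu X) \<cdot> r) = mu (Fo X) \<cdot> (Ta (phi X) \<cdot> (phi (To X) \<cdot> r))"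
proof -
  show *: "phi X \<cdot> Fa (mu X) = mu (Fo X) \<cdot> (Ta (phi X) \<cdot> phi (To X))"
    by (simp add: mu_phi)
  show "phi X \<cdot> (Fa (mu X) \<cdot> r) = mu (Fo X) \<cdot> (Ta (phi X) \<cdot> (phi (To X) \<cdot> r))"
    if "r \<in> Arr M" "Cod M r = Fo (To (To X))"
    using that by (auto simp: M.cmp_eq_cmp[OF *])
qed

context
  fixes X a
  assumes X: "(X, a) \<in> algebras"
begin

lemmas X_arr [simp] = algebras_arr[OF X]

text \<open>For the identity endofunctor with identity structure map, this is the pair
  \<open>mu X\<close>, \<open>Ta a\<close> that presents a module by free modules. In general
  \<open>F\<close> is applied to that presentation on the Kleisli side.\<close>

lemma parallel:
  "mu (Fo X) \<cdot> Ta (phi X) \<in> Hom M (To (Fo (To X))) (To (Fo X))"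
  "Ta (Fa a) \<in> Hom M (To (Fo (To X))) (To (Fo X))"
  by (auto simp: Hom_iff)

text \<open>Both arrows of the pair are module maps between free modules, so
  \<open>q \<cdot> mu (Fo X)\<close> coequalizes their images under the monad and descends along
  \<open>Ta q\<close>. The module laws are checked after precomposition with epis.\<close>

lemma coequalizer_algebra:
  assumes T: "preserves_coequalizers M M Ta"
    and q: "is_coequalizer M q (mu (Fo X) \<cdot> Ta (phi X)) (Ta (Fa a))"
  obtains z where "(Cod M q, z) \<in> algebras" "z \<cdot> Ta q = q \<cdot> mu (Fo X)"
proof -
  have q_arr [simp]: "q \<in> Arr M" "Dom M q = To (Fo X)" "Cod M q \<in> Obj M"
    using M.is_coequalizer_arr[OF q] by auto
  have q_eq: "q \<cdot> (mu (Fo X) \<cdot> Ta (phi X)) = q \<cdot> Ta (Fa a)"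
    using M.is_coequalizer_arr[OF q] by auto
  have Tq: "is_coequalizer M (Ta q) (Ta (mu (Fo X) \<cdot> Ta (phi X))) (Ta (Ta (Fa a)))"
    using T q by (simp add: preserves_coequalizers_def)
  then have TTq: "is_epi M (Ta (Ta q))"
    using T M.is_coequalizer_epi unfolding preserves_coequalizers_def by blast
  \<comment> \<open>This is linearity of the first arrow of the pair; for the second arrow it is
    naturality of \<open>mu\<close>.\<close>
  have mu_assoc': "mu (Fo X) \<cdot> (Ta (mu (Fo X)) \<cdot> Ta (Ta (phi X))) =
      mu (Fo X) \<cdot> (Ta (phi X) \<cdot> mu (Fo (To X)))"
    by (simp add: M.cmp_eq_cmp[OF mu_assoc] mu_natural_arr)
  have "(q \<cdot> mu (Fo X)) \<cdot> Ta (mu (Fo X) \<cdot> Ta (phi X)) = (q \<cdot> (mu (Fo X) \<cdot> Ta (phi X))) \<cdot> mu (Fo (To X))"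
    by (simp add: fun_cmp_arr mu_assoc')
  also have "\<dots> = (q \<cdot> mu (Fo X)) \<cdot> Ta (Ta (Fa a))"
    unfolding q_eq by (simp add: mu_natural_arr)
  finally obtain z where z [simp]: "z \<in> Arr M" "Dom M z = To (Cod M q)" "Cod M z = Cod M q"
    and zq: "z \<cdot> Ta q = q \<cdot> mu (Fo X)"
    using M.is_coequalizer_factor[OF Tq, of "q \<cdot> mu (Fo X)"] by auto
  have "z \<cdot> eta (Cod M q) = Ide M (Cod M q)"
  proof (rule M.is_epi_cancel_arr[OF M.is_coequalizer_epi[OF q]])
    show "(z \<cdot> eta (Cod M q)) \<cdot> q = Ide M (Cod M q) \<cdot> q"
      by (simp add: eta_natural_arr M.cmp_eq_cmp[OF zq] mu_eta_left)
  qed auto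
  \<comment> \<open>Associativity starts at the twofold image of \<open>Cod M q\<close> under the
    monad, so the epi to cancel is \<open>q\<close> with the monad applied twice.\<close>
  moreover have "z \<cdot> mu (Cod M q) = z \<cdot> Ta z"
  proof (rule M.is_epi_cancel_arr[OF TTq])
    have "(z \<cdot> Ta z) \<cdot> Ta (Ta q) = z \<cdot> Ta (z \<cdot> Ta q)"
      by (simp add: fun_cmp_arr)
    then show "(z \<cdot> mu (Cod M q)) \<cdot> Ta (Ta q) = (z \<cdot> Ta z) \<cdot> Ta (Ta q)"
      by (simp add: zq fun_cmp_arr mu_natural_arr M.cmp_eq_cmp[OF zq] mu_assoc)
  qed auto
  ultimately have "(Cod M q, z) \<in> algebras"
    by (simp add: algebras_def Hom_iff)
  then show thesis
    using that zq by blast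
qed

text \<open>Both sides reduce to \<open>q \<cdot> phi X\<close>: the left one because
  \<open>q\<close> coequalizes the pair, the right one because
  \<open>z \<cdot> Ta q = q \<cdot> mu (Fo X)\<close>; a unit law of the monad finishes
  each.\<close>

lemma coequalizer_lax_linear:
  assumes q: "is_coequalizer M q (mu (Fo X) \<cdot> Ta (phi X)) (Ta (Fa a))"
    and Z: "(Cod M q, z) \<in> algebras" and zq: "z \<cdot> Ta q = q \<cdot> mu (Fo X)"
  shows "q \<cdot> eta (Fo X) \<in> lax_linear_maps M Ta Fo Fa phi (X, a) (Cod M q, z)"
proof -
  have q_arr [simp]: "q \<in> Arr M" "Dom M q = To (Fo X)" "Cod M q \<in> Obj M"
    using M.is_coequalizer_arr[OF q] by auto
  have q_eq: "q \<cdot> (mu (Fo X) \<cdot> Ta (phi X)) = q \<cdot> Ta (Fa a)"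
    using M.is_coequalizer_arr[OF q] by auto
  note [simp] = algebras_arr[OF Z]
  have "(q \<cdot> eta (Fo X)) \<cdot> Fa a = (q \<cdot> Ta (Fa a)) \<cdot> eta (Fo (To X))"
    by (simp add: eta_natural_arr)
  also have "\<dots> = q \<cdot> (mu (Fo X) \<cdot> eta (To (Fo X)) \<cdot> phi X)"
    unfolding q_eq[symmetric] by (simp add: eta_natural_arr)
  also have "\<dots> = q \<cdot> phi X"
    by (simp add: M.cmp_eq_cmp[OF mu_eta_left])
  also have "\<dots> = z \<cdot> Ta (q \<cdot> eta (Fo X)) \<cdot> phi X"
    by (simp add: fun_cmp_arr M.cmp_eq_cmp[OF zq] M.cmp_eq_cmp[OF mu_eta_right])
  finally show ?thesis
    by (simp add: lax_linear_maps_def Hom_iff)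
qed

end

end

section \<open>Composites of lax endofunctors and the universal property of the coequalizer\<close>

locale lax_endofunctor_pair =
  F: lax_endofunctor K M To Ta mu eta Fo Fa phi + U: lax_endofunctor K M To Ta mu eta Uo Ua psi
  for K :: "('k, 'r) ring_scheme" and M :: "('k, 'm, 'g, 'd) lincat_scheme" (structure)
    and To :: "'m \<Rightarrow> 'm" and Ta :: "'g \<Rightarrow> 'g" and mu :: "'m \<Rightarrow> 'g" and eta :: "'m \<Rightarrow> 'g"
    and Fo :: "'m \<Rightarrow> 'm" and Fa :: "'g \<Rightarrow> 'g" and phi :: "'m \<Rightarrow> 'g"
    and Uo :: "'m \<Rightarrow> 'm" and Ua :: "'g \<Rightarrow> 'g" and psi :: "'m \<Rightarrow> 'g"
begin

text \<open>The structure map first moves the monad out of \<open>F\<close> underneath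
  \<open>U\<close>, then out of \<open>U\<close>; each law is the pasting of the laws for
  \<open>phi\<close> and \<open>psi\<close>.\<close>

lemma lax_endofunctor_comp:
  "lax_endofunctor K M To Ta mu eta (\<lambda>X. Uo (Fo X)) (\<lambda>x. Ua (Fa x)) (\<lambda>X. psi (Fo X) \<cdot> Ua (phi X))"
proof (intro_locales, unfold_locales)
  show "Uo (Fo A) \<in> Obj M" if "A \<in> Obj M" for A
    using that by (simp add: F.F.fun_obj U.F.fun_obj)
  show "Ua (Fa f) \<in> Hom M (Uo (Fo A)) (Uo (Fo B))" if "f \<in> Hom M A B" for f A B
    using that by (simp add: F.F.fun_hom U.F.fun_hom)
  show "Ua (Fa (Ide M A)) = Ide M (Uo (Fo A))" if "A \<in> Obj M" for A
    using that by (simp add: F.F.fun_ide U.F.fun_ide F.F.fun_obj)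
  show "Ua (Fa (g \<cdot> f)) = Ua (Fa g) \<cdot> Ua (Fa f)" if "f \<in> Hom M A B" "g \<in> Hom M B E" for f g A B E
    using that by (metis F.F.fun_cmp U.F.fun_cmp F.F.fun_hom)
  show "Ua (Fa (HAdd M f g)) = HAdd M (Ua (Fa f)) (Ua (Fa g))"
    if "f \<in> Hom M A B" "g \<in> Hom M A B" for f g A B
    using that by (metis F.F.fun_add U.F.fun_add F.F.fun_hom)
  show "Ua (Fa (HScale M c f)) = HScale M c (Ua (Fa f))" if "c \<in> carrier K" "f \<in> Hom M A B" for c f A B
    using that by (metis F.F.fun_scale U.F.fun_scale F.F.fun_hom)
  show "psi (Fo X) \<cdot> Ua (phi X) \<in> Hom M (Uo (Fo (To X))) (To (Uo (Fo X)))" if "X \<in> Obj M" for X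
    using that by (simp add: Hom_iff)
  show "(psi (Fo Y) \<cdot> Ua (phi Y)) \<cdot> Ua (Fa (Ta x)) = Ta (Ua (Fa x)) \<cdot> psi (Fo X) \<cdot> Ua (phi X)"
    if x: "x \<in> Hom M X Y" for x X Y
  proof -
    have [simp]: "x \<in> Arr M" "Dom M x = X" "Cod M x = Y" "X \<in> Obj M" "Y \<in> Obj M"
      using x by (auto simp: Hom_iff)
    have "Ua (phi Y) \<cdot> Ua (Fa (Ta x)) = Ua (Ta (Fa x)) \<cdot> Ua (phi X)"
      by (simp add: F.phi_natural_arr flip: U.F.fun_cmp_arr)
    then show ?thesis
      by (simp add: U.phi_natural_arr)
  qed
  fix X
  assume [simp]: "X \<in> Obj M"
  have "Ua (phi X) \<cdot> Ua (Fa (mu X)) = Ua (mu (Fo X)) \<cdot> (Ua (Ta (phi X)) \<cdot> Ua (phi (To X)))"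
    by (simp add: F.phi_mu flip: U.F.fun_cmp_arr)
  then show "mu (Uo (Fo X)) \<cdot> Ta (psi (Fo X) \<cdot> Ua (phi X)) \<cdot> psi (Fo (To X)) \<cdot> Ua (phi (To X)) =
      (psi (Fo X) \<cdot> Ua (phi X)) \<cdot> Ua (Fa (mu X))"
    by (simp add: F.fun_cmp_arr U.phi_natural_arr U.phi_mu)
  have "Ua (phi X) \<cdot> Ua (Fa (eta X)) = Ua (eta (Fo X))"
    by (simp add: F.phi_eta flip: U.F.fun_cmp_arr)
  then show "(psi (Fo X) \<cdot> Ua (phi X)) \<cdot> Ua (Fa (eta X)) = eta (Uo (Fo X))"
    by (simp add: U.phi_eta)
qed

context
  fixes X a Y b q z
  assumes X: "(X, a) \<in> F.algebras" and Y: "(Y, b) \<in> F.algebras"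
    and T: "preserves_coequalizers M M Ta" and U: "preserves_coequalizers M M Ua"
    and q: "is_coequalizer M q (mu (Fo X) \<cdot> Ta (phi X)) (Ta (Fa a))"
    and Z: "(Cod M q, z) \<in> F.algebras" and zq: "z \<cdot> Ta q = q \<cdot> mu (Fo X)"
begin

lemmas XYZ_arr [simp] = F.algebras_arr[OF X] F.algebras_arr[OF Y] F.algebras_arr[OF Z]

lemma q_arr [simp]: "q \<in> Arr M" "Dom M q = To (Fo X)"
  using F.M.is_coequalizer_arr[OF q] by auto

lemma Uq: "is_coequalizer M (Ua q) (Ua (mu (Fo X) \<cdot> Ta (phi X))) (Ua (Ta (Fa a)))"
  using U q by (simp add: preserves_coequalizers_def)

lemma UTq: "is_epi M (Ua (Ta q))"
  using T U q F.M.is_coequalizer_epi unfolding preserves_coequalizers_def by blast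

text \<open>Thus \<open>q\<close> is the module map out of the free module that extends
  \<open>q \<cdot> eta (Fo X)\<close>.\<close>

lemma z_Tq_eta: "z \<cdot> (Ta q \<cdot> Ta (eta (Fo X))) = q"
  by (simp add: F.M.cmp_eq_cmp[OF zq] F.mu_eta_right)

lemma lax_linear_mapsD:
  assumes "g \<in> lax_linear_maps M Ta Uo Ua psi (Cod M q, z) (Y, b)"
  shows "g \<in> Arr M" "Dom M g = Uo (Cod M q)" "Cod M g = Y" "g \<cdot> Ua z = b \<cdot> (Ta g \<cdot> psi (Cod M q))"
  using assms by (auto simp: lax_linear_maps_def Hom_iff)

text \<open>Linearity of \<open>q \<cdot> eta (Fo X)\<close>, taken under \<open>U\<close>, turns
  \<open>Ua (Fa a)\<close> into \<open>Ua z\<close>, which linearity of \<open>g\<close> moves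
  across \<open>g\<close>.\<close>

lemma restrict_lax_linear:
  assumes g: "g \<in> lax_linear_maps M Ta Uo Ua psi (Cod M q, z) (Y, b)"
  shows "g \<cdot> Ua (q \<cdot> eta (Fo X)) \<in>
    lax_linear_maps M Ta (\<lambda>X. Uo (Fo X)) (\<lambda>x. Ua (Fa x)) (\<lambda>X. psi (Fo X) \<cdot> Ua (phi X)) (X, a) (Y, b)"
proof -
  note [simp] = lax_linear_mapsD(1-3)[OF g]
  let ?p = "q \<cdot> eta (Fo X)"
  have p: "?p \<cdot> Fa a = z \<cdot> (Ta ?p \<cdot> phi X)"
    using F.coequalizer_lax_linear[OF X q Z zq] by (simp add: lax_linear_maps_def)
  have "(g \<cdot> Ua ?p) \<cdot> Ua (Fa a) = g \<cdot> Ua (?p \<cdot> Fa a)"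
    by (simp add: U.F.fun_cmp_arr)
  also have "\<dots> = b \<cdot> (Ta (g \<cdot> Ua ?p) \<cdot> (psi (Fo X) \<cdot> Ua (phi X)))"
    unfolding p
    by (simp add: U.F.fun_cmp_arr F.fun_cmp_arr F.M.cmp_eq_cmp[OF lax_linear_mapsD(4)[OF g]]
        U.phi_natural_arr)
  finally show ?thesis
    by (simp add: lax_linear_maps_def Hom_iff)
qed

text \<open>Recovers \<open>g \<cdot> Ua q\<close> from the restriction of \<open>g\<close>. This
  gives injectivity and dictates the formula for extending a map.\<close>

lemma lax_linear_cmp_q:
  assumes g: "g \<in> lax_linear_maps M Ta Uo Ua psi (Cod M q, z) (Y, b)"
  shows "g \<cdot> Ua q = b \<cdot> (Ta (g \<cdot> Ua (q \<cdot> eta (Fo X))) \<cdot> psi (Fo X))"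
proof -
  note [simp] = lax_linear_mapsD(1-3)[OF g]
  have "g \<cdot> Ua q = g \<cdot> Ua (z \<cdot> (Ta q \<cdot> Ta (eta (Fo X))))"
    by (simp only: z_Tq_eta)
  also have "\<dots> = b \<cdot> (Ta (g \<cdot> Ua (q \<cdot> eta (Fo X))) \<cdot> psi (Fo X))"
    by (simp add: U.F.fun_cmp_arr F.fun_cmp_arr F.M.cmp_eq_cmp[OF lax_linear_mapsD(4)[OF g]]
        U.phi_natural_arr)
  finally show ?thesis .
qed

lemma extend_lax_linear:
  assumes f: "f \<in> lax_linear_maps M Ta (\<lambda>X. Uo (Fo X)) (\<lambda>x. Ua (Fa x)) (\<lambda>X. psi (Fo X) \<cdot> Ua (phi X))
    (X, a) (Y, b)"
  shows "\<exists>g \<in> lax_linear_maps M Ta Uo Ua psi (Cod M q, z) (Y, b). g \<cdot> Ua (q \<cdot> eta (Fo X)) = f"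
proof -
  have f_arr [simp]: "f \<in> Arr M" "Dom M f = Uo (Fo X)" "Cod M f = Y"
    and f_lin: "f \<cdot> Ua (Fa a) = b \<cdot> (Ta f \<cdot> (psi (Fo X) \<cdot> Ua (phi X)))"
    using f by (auto simp: lax_linear_maps_def Hom_iff)
  have b_Tb: "b \<cdot> (Ta b \<cdot> x) = b \<cdot> (mu Y \<cdot> x)" if "x \<in> Arr M" "Cod M x = To (To Y)" for x
    using that F.M.cmp_eq_cmp[of b "Ta b" "b \<cdot> mu Y" x] by simp
  have Tf_lin: "Ta f \<cdot> Ta (Ua (Fa a)) = Ta (b \<cdot> (Ta f \<cdot> (psi (Fo X) \<cdot> Ua (phi X))))"
    by (simp flip: f_lin F.fun_cmp_arr)
  \<comment> \<open>By \<open>lax_linear_cmp_q\<close>, the only possible value of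
    \<open>g \<cdot> Ua q\<close>.\<close>
  let ?f = "b \<cdot> (Ta f \<cdot> psi (Fo X))"
  have "?f \<cdot> Ua (mu (Fo X) \<cdot> Ta (phi X)) = ?f \<cdot> Ua (Ta (Fa a))"
    by (simp add: U.F.fun_cmp_arr F.fun_cmp_arr U.phi_mu U.phi_natural_arr F.M.cmp_eq_cmp[OF Tf_lin]
        b_Tb F.mu_natural_arr)
  then obtain g where g [simp]: "g \<in> Arr M" "Dom M g = Uo (Cod M q)" "Cod M g = Y"
    and gq: "g \<cdot> Ua q = ?f"
    using F.M.is_coequalizer_factor[OF Uq, of ?f] by auto
  \<comment> \<open>After precomposition with the epi \<open>Ua (Ta q)\<close>, both sides are
    expressed through \<open>f\<close>; they agree by associativity of the module \<open>b\<close>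
    and naturality of \<open>mu\<close>.\<close>
  have "g \<cdot> Ua z = b \<cdot> (Ta g \<cdot> psi (Cod M q))"
  proof (rule F.M.is_epi_cancel_arr[OF UTq])
    have "(g \<cdot> Ua z) \<cdot> Ua (Ta q) = g \<cdot> Ua (z \<cdot> Ta q)"
      by (simp add: U.F.fun_cmp_arr)
    also have "\<dots> = b \<cdot> (Ta f \<cdot> (mu (Uo (Fo X)) \<cdot> (Ta (psi (Fo X)) \<cdot> psi (To (Fo X)))))"
      by (simp add: zq U.F.fun_cmp_arr F.M.cmp_eq_cmp[OF gq] U.phi_mu)
    also have "\<dots> = b \<cdot> (Ta ?f \<cdot> psi (To (Fo X)))"
      by (simp add: F.fun_cmp_arr b_Tb F.mu_natural_arr)
    also have "\<dots> = (b \<cdot> (Ta g \<cdot> psi (Cod M q))) \<cdot> Ua (Ta q)"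
      by (simp add: U.phi_natural_arr F.fun_cmp_arr flip: gq)
    finally show "(g \<cdot> Ua z) \<cdot> Ua (Ta q) = (b \<cdot> (Ta g \<cdot> psi (Cod M q))) \<cdot> Ua (Ta q)" .
  qed auto
  then have "g \<in> lax_linear_maps M Ta Uo Ua psi (Cod M q, z) (Y, b)"
    by (simp add: lax_linear_maps_def Hom_iff)
  \<comment> \<open>Here \<open>psi\<close> absorbs the unit, and the unit law of \<open>b\<close>
    then returns \<open>f\<close>.\<close>
  moreover have "g \<cdot> Ua (q \<cdot> eta (Fo X)) = b \<cdot> (eta Y \<cdot> f)"
    by (simp add: U.F.fun_cmp_arr F.M.cmp_eq_cmp[OF gq] U.phi_eta F.eta_natural_arr)
  then have "g \<cdot> Ua (q \<cdot> eta (Fo X)) = f"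
    by (subst (asm) F.M.cmp_eq_cmp) auto
  ultimately show ?thesis
    by blast
qed

lemma coequalizer_universal:
  "bij_betw (\<lambda>g. g \<cdot> Ua (q \<cdot> eta (Fo X))) (lax_linear_maps M Ta Uo Ua psi (Cod M q, z) (Y, b))
    (lax_linear_maps M Ta (\<lambda>X. Uo (Fo X)) (\<lambda>x. Ua (Fa x)) (\<lambda>X. psi (Fo X) \<cdot> Ua (phi X)) (X, a) (Y, b))"
  unfolding bij_betw_def
proof
  show "inj_on (\<lambda>g. g \<cdot> Ua (q \<cdot> eta (Fo X))) (lax_linear_maps M Ta Uo Ua psi (Cod M q, z) (Y, b))"
  proof (rule inj_onI)
    fix g h
    assume g: "g \<in> lax_linear_maps M Ta Uo Ua psi (Cod M q, z) (Y, b)"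
      and h: "h \<in> lax_linear_maps M Ta Uo Ua psi (Cod M q, z) (Y, b)"
      and "g \<cdot> Ua (q \<cdot> eta (Fo X)) = h \<cdot> Ua (q \<cdot> eta (Fo X))"
    then have "g \<cdot> Ua q = h \<cdot> Ua q"
      by (simp only: lax_linear_cmp_q)
    then show "g = h"
      by (rule F.M.is_epi_cancel_arr[OF F.M.is_coequalizer_epi[OF Uq]])
        (use lax_linear_mapsD(1-3)[OF g] lax_linear_mapsD(1-3)[OF h] in auto)
  qed
qed (use restrict_lax_linear extend_lax_linear in blast)

end

end

section \<open>Multilinear morphisms\<close>

text \<open>The arrows \<open>th\<close> and \<open>th\<^sub>T\<close> stand for the components at
  \<open>X\<close> and \<open>To X\<close> of an isomorphism from \<open>G\<close> to
  \<open>F\<close>. The linearity condition for \<open>f \<cdot> th\<close> is the one for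
  \<open>f\<close> precomposed with \<open>th\<^sub>T\<close>, which can be cancelled.\<close>

lemma (in linear_monad) bij_betw_cmp_iso:
  assumes th: "inverse_arrows M th th'" and th\<^sub>T: "inverse_arrows M th\<^sub>T th\<^sub>T'"
    and dom: "Dom M th = Go X" "Cod M th = Fo X" "Dom M th\<^sub>T = Go (To X)" "Cod M th\<^sub>T = Fo (To X)"
    and F: "Fa a \<in> Hom M (Fo (To X)) (Fo X)" "phi X \<in> Hom M (Fo (To X)) (To (Fo X))"
    and G: "Ga a \<in> Hom M (Go (To X)) (Go X)" "gam X \<in> Hom M (Go (To X)) (To (Go X))"
    and b: "b \<in> Hom M (To Y) Y"
    and natural: "Fa a \<cdot> th\<^sub>T = th \<cdot> Ga a"
    and lax: "Ta th \<cdot> gam X = phi X \<cdot> th\<^sub>T"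
  shows "bij_betw (\<lambda>f. f \<cdot> th) (lax_linear_maps M Ta Fo Fa phi (X, a) (Y, b))
    (lax_linear_maps M Ta Go Ga gam (X, a) (Y, b))"
proof -
  note th_arr [simp] = M.inverse_arrows_arr[OF th] M.inverse_arrows_arr[OF th\<^sub>T] dom
  have [simp]: "Fa a \<in> Arr M" "Dom M (Fa a) = Fo (To X)" "Cod M (Fa a) = Fo X"
    "phi X \<in> Arr M" "Dom M (phi X) = Fo (To X)" "Cod M (phi X) = To (Fo X)"
    "Ga a \<in> Arr M" "Dom M (Ga a) = Go (To X)" "Cod M (Ga a) = Go X"
    "gam X \<in> Arr M" "Dom M (gam X) = Go (To X)" "Cod M (gam X) = To (Go X)"
    "b \<in> Arr M" "Dom M b = To Y" "Cod M b = Y"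
    using F G b by (auto simp: Hom_iff)
  have epi: "f = g" if "f \<cdot> k = g \<cdot> k" "inverse_arrows M k k'" "f \<in> Arr M" "g \<in> Arr M"
    "Dom M f = Cod M k" "Dom M g = Cod M k" for f g k k'
  proof -
    note [simp] = M.inverse_arrows_arr[OF that(2)]
    have "f \<cdot> (k \<cdot> k') = g \<cdot> (k \<cdot> k')"
      using that(3-) by (subst (1 2) M.cmp_assoc_arr[symmetric]) (auto simp: that(1) simp del: M.cmp_assoc_arr)
    then show ?thesis
      using that by simp
  qed
  have iff: "f \<cdot> th \<in> lax_linear_maps M Ta Go Ga gam (X, a) (Y, b) \<longleftrightarrow>
      f \<in> lax_linear_maps M Ta Fo Fa phi (X, a) (Y, b)" if f: "f \<in> Hom M (Fo X) Y" for f
  proof -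
    have [simp]: "f \<in> Arr M" "Dom M f = Fo X" "Cod M f = Y"
      using f by (auto simp: Hom_iff)
    have "(f \<cdot> th) \<cdot> Ga a = (f \<cdot> Fa a) \<cdot> th\<^sub>T"
      by (simp add: natural)
    moreover have "b \<cdot> Ta (f \<cdot> th) \<cdot> gam X = (b \<cdot> Ta f \<cdot> phi X) \<cdot> th\<^sub>T"
      by (simp add: fun_cmp_arr lax)
    moreover have "(f \<cdot> Fa a) \<cdot> th\<^sub>T = (b \<cdot> Ta f \<cdot> phi X) \<cdot> th\<^sub>T \<longleftrightarrow> f \<cdot> Fa a = b \<cdot> Ta f \<cdot> phi X"
      using epi[OF _ th\<^sub>T, of "f \<cdot> Fa a" "b \<cdot> Ta f \<cdot> phi X"]
      by (auto simp del: M.cmp_assoc_arr)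
    ultimately show ?thesis
      by (auto simp: lax_linear_maps_def Hom_iff)
  qed
  show ?thesis
  proof (rule bij_betw_imageI)
    show "inj_on (\<lambda>f. f \<cdot> th) (lax_linear_maps M Ta Fo Fa phi (X, a) (Y, b))"
      by (rule inj_onI, rule epi[OF _ th]) (auto simp: lax_linear_maps_def Hom_iff)
    have "\<exists>f \<in> lax_linear_maps M Ta Fo Fa phi (X, a) (Y, b). g = f \<cdot> th"
      if g: "g \<in> lax_linear_maps M Ta Go Ga gam (X, a) (Y, b)" for g
    proof -
      have [simp]: "g \<in> Arr M" "Dom M g = Go X" "Cod M g = Y"
        using g by (auto simp: lax_linear_maps_def Hom_iff)
      have "(g \<cdot> th') \<cdot> th = g" "g \<cdot> th' \<in> Hom M (Fo X) Y"
        by (auto simp: Hom_iff)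
      then show ?thesis
        using iff[of "g \<cdot> th'"] g by metis
    qed
    moreover have "f \<cdot> th \<in> lax_linear_maps M Ta Go Ga gam (X, a) (Y, b)"
      if "f \<in> lax_linear_maps M Ta Fo Fa phi (X, a) (Y, b)" for f
      using iff[of f] that by (auto simp: lax_linear_maps_def)
    ultimately show "(\<lambda>f. f \<cdot> th) ` lax_linear_maps M Ta Fo Fa phi (X, a) (Y, b) =
        lax_linear_maps M Ta Go Ga gam (X, a) (Y, b)"
      by auto
  qed
qed

section \<open>Iterated actions and their coherence isomorphisms\<close>

context bilinear_functor
begin

declare bifun_obj [simp]

lemma bifun_arr [simp]:
  assumes "f \<in> Arr C" "g \<in> Arr D"
  shows "Fa f g \<in> Arr E" "Dom E (Fa f g) = Fo (Dom C f) (Dom D g)"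
    "Cod E (Fa f g) = Fo (Cod C f) (Cod D g)"
  using bifun_hom[of f "Dom C f" "Cod C f" g "Dom D g" "Cod D g"] assms by (auto simp: Hom_iff)

lemma bifun_cmp_arr:
  "f \<in> Arr C \<Longrightarrow> f' \<in> Arr C \<Longrightarrow> g \<in> Arr D \<Longrightarrow> g' \<in> Arr D \<Longrightarrow> Dom C f' = Cod C f \<Longrightarrow> Dom D g' = Cod D g
    \<Longrightarrow> Fa f' g' \<cdot>\<^bsub>E\<^esub> Fa f g = Fa (f' \<cdot>\<^bsub>C\<^esub> f) (g' \<cdot>\<^bsub>D\<^esub> g)"
  by (rule bifun_cmp[symmetric]) (auto simp: Hom_iff)

lemma bifun_cmp_arr_assoc:
  assumes "f \<in> Arr C" "f' \<in> Arr C" "g \<in> Arr D" "g' \<in> Arr D" "Dom C f' = Cod C f" "Dom D g' = Cod D g"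
    and "r \<in> Arr E" "Cod E r = Fo (Dom C f) (Dom D g)"
  shows "Fa f' g' \<cdot>\<^bsub>E\<^esub> (Fa f g \<cdot>\<^bsub>E\<^esub> r) = Fa (f' \<cdot>\<^bsub>C\<^esub> f) (g' \<cdot>\<^bsub>D\<^esub> g) \<cdot>\<^bsub>E\<^esub> r"
  by (subst E.cmp_eq_cmp[OF bifun_cmp_arr]) (use assms in auto)

lemma bifun_inverse_arrows:
  assumes "inverse_arrows C f f'" "inverse_arrows D g g'"
  shows "inverse_arrows E (Fa f g) (Fa f' g')"
proof -
  note [simp] = C.inverse_arrows_arr[OF assms(1)] D.inverse_arrows_arr[OF assms(2)]
  show ?thesis
    by (rule E.inverse_arrowsI) (auto simp: bifun_cmp_arr bifun_ide)
qed

lemma linear_functor_right: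
  assumes [simp]: "A \<in> Obj C"
  shows "linear_functor K D E (Fo A) (Fa (Ide C A))"
proof (intro_locales, unfold_locales)
  have ide: "Ide C A \<in> Hom C A A"
    by (rule C.ide_hom) simp
  show "Fa (Ide C A) f \<in> Hom E (Fo A B) (Fo A B')" if "f \<in> Hom D B B'" for f B B'
    using bifun_hom[OF ide that] .
  show "Fa (Ide C A) (g \<cdot>\<^bsub>D\<^esub> f) = Fa (Ide C A) g \<cdot>\<^bsub>E\<^esub> Fa (Ide C A) f"
    if "f \<in> Hom D B B'" "g \<in> Hom D B' B''" for f g B B' B''
    using bifun_cmp[OF ide ide that] by simp
  show "Fa (Ide C A) (HAdd D f g) = HAdd E (Fa (Ide C A) f) (Fa (Ide C A) g)"
    if "f \<in> Hom D B B'" "g \<in> Hom D B B'" for f g B B'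
    using bifun_add_right[OF ide that] .
  show "Fa (Ide C A) (HScale D c f) = HScale E c (Fa (Ide C A) f)"
    if "c \<in> carrier K" "f \<in> Hom D B B'" for c f B B'
    using bifun_scale_right[OF that(1) ide that(2)] .
qed (auto simp: bifun_ide)

end

context monoidal_category
begin

text \<open>The rule \<open>induct_list012\<close> follows the equations of
  \<open>tens_list\<close>, where a one-element product is the object itself without a unit
  factor.\<close>

lemma tens_list_obj: "Vs \<in> lists (Obj C) \<Longrightarrow> tens_list C Vs \<in> Obj C"
  by (induction Vs rule: induct_list012) (auto simp: tunit_obj)

end

context module_category
begin

lemma massoc_arr [simp]:
  assumes "V \<in> Obj C" "W \<in> Obj C" "X \<in> Obj M"
  shows "massoc M V W X \<in> Arr M" "Dom M (massoc M V W X) = (V \<boxtimes>\<^bsub>C\<^esub> W) \<triangleright> X"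
    "Cod M (massoc M V W X) = V \<triangleright> (W \<triangleright> X)"
  using massoc_hom[OF assms] by (auto simp: Hom_iff)

lemma munit_arr [simp]:
  assumes "X \<in> Obj M"
  shows "munit M X \<in> Arr M" "Dom M (munit M X) = tunit C \<triangleright> X" "Cod M (munit M X) = X"
  using munit_hom[OF assms] by (auto simp: Hom_iff)

lemma linear_functor_act_list:
  "Vs \<in> lists (Obj C) \<Longrightarrow> linear_functor K M M (act_list M Vs) (act_list_arr C M Vs)"
proof (induction Vs)
  case Nil
  show ?case
    by (intro_locales, unfold_locales) auto
next
  case (Cons V Vs)
  then interpret Vs: linear_functor K M M "act_list M Vs" "act_list_arr C M Vs"
    by auto
  interpret V: linear_functor K M M "\<lambda>X. V \<triangleright> X" "\<lambda>x. Ide C V \<triangleright>\<^sub>a x"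
    using Cons action.linear_functor_right by auto
  show ?case
  proof (intro_locales, unfold_locales, goal_cases)
    case (2 f A B)
    then show ?case
      by (simp add: Hom_iff)
  qed (simp_all add: Vs.fun_ide V.fun_ide Vs.fun_cmp Vs.fun_add Vs.fun_scale
      V.fun_cmp[OF Vs.fun_hom Vs.fun_hom] V.fun_add[OF Vs.fun_hom Vs.fun_hom] V.fun_scale[OF _ Vs.fun_hom])
qed

lemma spread_hom:
  assumes "Vs \<in> lists (Obj C)" "X \<in> Obj M"
  shows "spread C M Vs X \<in> Hom M (tens_list C Vs \<triangleright> X) (act_list M Vs X)"
  using assms(1)
proof (induction Vs rule: induct_list012)
  case (3 V W Vs)
  then have "tens_list C (W # Vs) \<in> Obj C"
    by (intro C.tens_list_obj) auto
  with 3 assms(2) show ?case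
    by (auto simp: Hom_iff)
qed (use assms(2) in \<open>auto simp: Hom_iff\<close>)

lemma spread_iso:
  assumes "Vs \<in> lists (Obj C)" "X \<in> Obj M"
  shows "is_iso M (spread C M Vs X)"
  using assms(1)
proof (induction Vs rule: induct_list012)
  case 1
  show ?case
    using munit_iso assms(2) by simp
next
  case (2 V)
  then show ?case
    using M.inverse_arrows_ide[of "V \<triangleright> X"] assms(2) by (auto simp: is_iso_def)
next
  case (3 V W Vs)
  then have [simp]: "V \<in> Obj C" "tens_list C (W # Vs) \<in> Obj C" and Vs: "W # Vs \<in> lists (Obj C)"
    using C.tens_list_obj[of "W # Vs"] by auto
  have "is_iso M (spread C M (W # Vs) X)"
    using 3 by simp
  then obtain s where "inverse_arrows M (spread C M (W # Vs) X) s"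
    by (auto simp: is_iso_def)
  then have "inverse_arrows M (Ide C V \<triangleright>\<^sub>a spread C M (W # Vs) X) (Ide C V \<triangleright>\<^sub>a s)"
    by (intro action.bifun_inverse_arrows C.inverse_arrows_ide) auto
  moreover obtain m where "inverse_arrows M (massoc M V (tens_list C (W # Vs)) X) m"
    using massoc_iso[of V "tens_list C (W # Vs)" X] assms(2) by (auto simp: is_iso_def)
  ultimately have "inverse_arrows M (spread C M (V # W # Vs) X) (m \<cdot> (Ide C V \<triangleright>\<^sub>a s))"
    using M.inverse_arrows_cmp[of "massoc M V (tens_list C (W # Vs)) X" m
        "Ide C V \<triangleright>\<^sub>a spread C M (W # Vs) X" "Ide C V \<triangleright>\<^sub>a s"]
      spread_hom[OF Vs assms(2)] assms(2)
    by (simp add: Hom_iff)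
  then show ?case
    unfolding is_iso_def by blast
qed

text \<open>Prepending an object combines naturality of \<open>massoc\<close> with the induction
  hypothesis under the action of that object.\<close>

lemma spread_natural:
  assumes "Vs \<in> lists (Obj C)" "x \<in> Hom M X Y"
  shows "spread C M Vs Y \<cdot> (Ide C (tens_list C Vs) \<triangleright>\<^sub>a x) = act_list_arr C M Vs x \<cdot> spread C M Vs X"
  using assms(1)
proof (induction Vs rule: induct_list012)
  case 1
  show ?case
    using munit_natural[OF assms(2)] by simp
next
  case (2 V)
  then show ?case
    using assms(2) by (auto simp: Hom_iff)
next
  case (3 V W Vs)
  let ?t = "tens_list C (W # Vs)" and ?s = "spread C M (W # Vs)" and ?f = "act_list_arr C M (W # Vs) x"
  have Vs: "W # Vs \<in> lists (Obj C)" and [simp]: "V \<in> Obj C" "?t \<in> Obj C"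
    using 3 C.tens_list_obj[of "W # Vs"] by auto
  have x [simp]: "x \<in> Arr M" "Dom M x = X" "Cod M x = Y" "X \<in> Obj M" "Y \<in> Obj M"
    using assms(2) by (auto simp: Hom_iff)
  have [simp]: "?s Z \<in> Arr M" "Dom M (?s Z) = ?t \<triangleright> Z" "Cod M (?s Z) = act_list M (W # Vs) Z" if "Z \<in> Obj M" for Z
    using spread_hom[OF Vs that] by (auto simp: Hom_iff simp del: act_list.simps)
  interpret Vs: linear_functor K M M "act_list M (W # Vs)" "act_list_arr C M (W # Vs)"
    by (rule linear_functor_act_list[OF Vs])
  have IH: "?s Y \<cdot> (Ide C ?t \<triangleright>\<^sub>a x) = ?f \<cdot> ?s X"
    using 3 by simp
  \<comment> \<open>Naturality with identities in both variables of \<open>C\<close>; their tensor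
    product is again an identity.\<close>
  have m: "massoc M V ?t Y \<cdot> (Ide C (V \<boxtimes>\<^bsub>C\<^esub> ?t) \<triangleright>\<^sub>a x) =
      (Ide C V \<triangleright>\<^sub>a (Ide C ?t \<triangleright>\<^sub>a x)) \<cdot> massoc M V ?t X"
    using massoc_natural[OF C.ide_hom C.ide_hom assms(2), of V ?t] by (simp add: C.tensor.bifun_ide)
  have "((Ide C V \<triangleright>\<^sub>a ?s Y) \<cdot> massoc M V ?t Y) \<cdot> (Ide C (V \<boxtimes>\<^bsub>C\<^esub> ?t) \<triangleright>\<^sub>a x) =
      (Ide C V \<triangleright>\<^sub>a ?f) \<cdot> ((Ide C V \<triangleright>\<^sub>a ?s X) \<cdot> massoc M V ?t X)"
    by (simp add: m action.bifun_cmp_arr_assoc IH del: act_list_arr.simps spread.simps tens_list.simps)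
  then show ?case
    by simp
qed

lemma act_list_append: "act_list M (Us @ Vs) X = act_list M Us (act_list M Vs X)"
  by (induction Us) auto

lemma act_list_arr_append: "act_list_arr C M (Us @ Vs) x = act_list_arr C M Us (act_list_arr C M Vs x)"
  by (induction Us) auto

end

section \<open>The lax structure of iterated actions\<close>

context lax_module_monad
begin

lemma linear_monad: "linear_monad K M (T_o T) (T_a T) (mu T) (eta T)"
  by (intro_locales, unfold_locales)
    (fact mu_hom mu_natural eta_hom eta_natural mu_assoc mu_eta_left mu_eta_right)+

lemma lax_endofunctor_act:
  assumes V: "V \<in> Obj C"
  shows "lax_endofunctor K M (T_o T) (T_a T) (mu T) (eta T) (\<lambda>X. V \<triangleright> X) (\<lambda>x. Ide C V \<triangleright>\<^sub>a x) (lax T V)"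
proof -
  interpret linear_monad K M "T_o T" "T_a T" "mu T" "eta T"
    by (rule linear_monad)
  interpret V: linear_functor K M M "\<lambda>X. V \<triangleright> X" "\<lambda>x. Ide C V \<triangleright>\<^sub>a x"
    by (rule action.linear_functor_right[OF V])
  show ?thesis
    by (intro_locales, unfold_locales)
      (use V lax_hom lax_natural[OF C.ide_hom] mu_module eta_module in auto)
qed

text \<open>The recursion of \<open>lax_list\<close> is the structure map of
  \<open>lax_endofunctor_comp\<close> for the first action after the remaining ones.\<close>

lemma lax_endofunctor_act_list:
  "Vs \<in> lists (Obj C) \<Longrightarrow> lax_endofunctor K M (T_o T) (T_a T) (mu T) (eta T)
    (act_list M Vs) (act_list_arr C M Vs) (lax_list C M T Vs)"
proof (induction Vs)
  case Nil
  interpret linear_monad K M "T_o T" "T_a T" "mu T" "eta T"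
    by (rule linear_monad)
  interpret V: linear_functor K M M "act_list M []" "act_list_arr C M []"
    by (rule linear_functor_act_list) simp
  show ?case
    by (intro_locales, unfold_locales) (auto simp: Hom_iff T.fun_ide)
next
  case (Cons V Vs)
  then interpret VVs: lax_endofunctor_pair K M "T_o T" "T_a T" "mu T" "eta T"
    "act_list M Vs" "act_list_arr C M Vs" "lax_list C M T Vs"
    "\<lambda>X. V \<triangleright> X" "\<lambda>x. Ide C V \<triangleright>\<^sub>a x" "lax T V"
    by (intro lax_endofunctor_pair.intro lax_endofunctor_act) auto
  show ?case
    using VVs.lax_endofunctor_comp by simp
qed

lemma lax_endofunctor_pair_act_list:
  "Us \<in> lists (Obj C) \<Longrightarrow> Vs \<in> lists (Obj C) \<Longrightarrow>
    lax_endofunctor_pair K M (T_o T) (T_a T) (mu T) (eta T)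
      (act_list M Vs) (act_list_arr C M Vs) (lax_list C M T Vs)
      (act_list M Us) (act_list_arr C M Us) (lax_list C M T Us)"
  by (intro lax_endofunctor_pair.intro lax_endofunctor_act_list)

lemma multilinear_eq:
  "multilinear C M T Vs X Y =
    lax_linear_maps M (T_a T) (act_list M Vs) (act_list_arr C M Vs) (lax_list C M T Vs) X Y"
  by (simp add: multilinear_def lax_linear_maps_def)

text \<open>Identifies the lax structure of a concatenation with that of a composite endofunctor, so
  that results on \<open>lax_endofunctor_pair\<close> apply to \<open>Us @ Vs\<close>.\<close>

lemma lax_list_append:
  assumes "Us \<in> lists (Obj C)" "Vs \<in> lists (Obj C)" "X \<in> Obj M"
  shows "lax_list C M T (Us @ Vs) X =
    lax_list C M T Us (act_list M Vs X) \<cdot> act_list_arr C M Us (lax_list C M T Vs X)"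
  using assms(1)
proof (induction Us)
  case Nil
  interpret Vs: lax_endofunctor K M "T_o T" "T_a T" "mu T" "eta T"
    "act_list M Vs" "act_list_arr C M Vs" "lax_list C M T Vs"
    by (rule lax_endofunctor_act_list[OF assms(2)])
  show ?case
    using assms(3) by simp
next
  case (Cons U Us)
  then interpret UV: lax_endofunctor_pair K M "T_o T" "T_a T" "mu T" "eta T"
    "act_list M Vs" "act_list_arr C M Vs" "lax_list C M T Vs"
    "act_list M Us" "act_list_arr C M Us" "lax_list C M T Us"
    by (intro lax_endofunctor_pair_act_list assms) auto
  interpret U: lax_endofunctor K M "T_o T" "T_a T" "mu T" "eta T" "\<lambda>X. U \<triangleright> X" "\<lambda>x. Ide C U \<triangleright>\<^sub>a x" "lax T U"
    using Cons by (intro lax_endofunctor_act) auto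
  show ?case
    using Cons assms(3) by (simp add: act_list_append U.F.fun_cmp_arr)
qed

lemma multilinear_append:
  assumes "Us \<in> lists (Obj C)" "Vs \<in> lists (Obj C)" "fst X \<in> Obj M"
  shows "multilinear C M T (Us @ Vs) X Y =
    lax_linear_maps M (T_a T) (\<lambda>X. act_list M Us (act_list M Vs X))
      (\<lambda>x. act_list_arr C M Us (act_list_arr C M Vs x))
      (\<lambda>X. lax_list C M T Us (act_list M Vs X) \<cdot> act_list_arr C M Us (lax_list C M T Vs X)) X Y"
  using assms by (simp add: multilinear_eq lax_linear_maps_def act_list_append act_list_arr_append lax_list_append)

lemma lax_arr [simp]:
  assumes "V \<in> Obj C" "X \<in> Obj M"
  shows "lax T V X \<in> Arr M" "Dom M (lax T V X) = V \<triangleright> T_o T X" "Cod M (lax T V X) = T_o T (V \<triangleright> X)"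
  using lax_hom[OF assms] by (auto simp: Hom_iff)

text \<open>The empty list is \<open>lax_munit\<close>; prepending an object uses
  \<open>lax_massoc\<close>, naturality of \<open>lax\<close> and the induction hypothesis.\<close>

lemma spread_lax:
  assumes "Vs \<in> lists (Obj C)" "X \<in> Obj M"
  shows "T_a T (spread C M Vs X) \<cdot> lax T (tens_list C Vs) X =
    lax_list C M T Vs X \<cdot> spread C M Vs (T_o T X)"
  using assms(1)
proof (induction Vs rule: induct_list012)
  case 1
  then show ?case
    using lax_munit[OF assms(2)] assms(2) by simp
next
  case (2 V)
  then show ?case
    using assms(2) by (simp add: T.fun_ide action.bifun_ide)
next
  case (3 V W Vs)
  let ?t = "tens_list C (W # Vs)" and ?s = "spread C M (W # Vs)" and ?l = "lax_list C M T (W # Vs) X"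
  note [simp] = assms(2)
  \<comment> \<open>The recursion stays folded so that \<open>W # Vs\<close> remains the block to
    which the induction hypothesis refers.\<close>
  note [simp del] = act_list_arr.simps act_list.simps spread.simps tens_list.simps lax_list.simps
  have Vs: "W # Vs \<in> lists (Obj C)" and [simp]: "V \<in> Obj C" "?t \<in> Obj C"
    using 3 C.tens_list_obj[of "W # Vs"] by auto
  have [simp]: "?s Z \<in> Arr M" "Dom M (?s Z) = ?t \<triangleright> Z" "Cod M (?s Z) = act_list M (W # Vs) Z" if "Z \<in> Obj M" for Z
    using spread_hom[OF Vs that] by (auto simp: Hom_iff)
  interpret Vs: lax_endofunctor K M "T_o T" "T_a T" "mu T" "eta T"
    "act_list M (W # Vs)" "act_list_arr C M (W # Vs)" "lax_list C M T (W # Vs)"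
    by (rule lax_endofunctor_act_list[OF Vs])
  interpret V: lax_endofunctor K M "T_o T" "T_a T" "mu T" "eta T" "\<lambda>X. V \<triangleright> X" "\<lambda>x. Ide C V \<triangleright>\<^sub>a x" "lax T V"
    by (rule lax_endofunctor_act) simp
  have "T_a T ((Ide C V \<triangleright>\<^sub>a ?s X) \<cdot> massoc M V ?t X) \<cdot> lax T (V \<boxtimes>\<^bsub>C\<^esub> ?t) X =
      lax T V (act_list M (W # Vs) X) \<cdot> (Ide C V \<triangleright>\<^sub>a (T_a T (?s X) \<cdot> lax T ?t X)) \<cdot> massoc M V ?t (T_o T X)"
    by (simp add: T.fun_cmp_arr lax_massoc V.phi_natural_arr V.F.fun_cmp_arr)
  also have "T_a T (?s X) \<cdot> lax T ?t X = ?l \<cdot> ?s (T_o T X)"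
    using 3 by simp
  also have "lax T V (act_list M (W # Vs) X) \<cdot> (Ide C V \<triangleright>\<^sub>a (?l \<cdot> ?s (T_o T X))) \<cdot> massoc M V ?t (T_o T X) =
      (lax T V (act_list M (W # Vs) X) \<cdot> (Ide C V \<triangleright>\<^sub>a ?l)) \<cdot>
      ((Ide C V \<triangleright>\<^sub>a ?s (T_o T X)) \<cdot> massoc M V ?t (T_o T X))"
    by (simp add: V.F.fun_cmp_arr)
  finally show ?case
    by (simp only: spread.simps tens_list.simps lax_list.simps)
qed

end

section \<open>Universality of isomorphisms of the base\<close>

context lax_module_monad
begin

context
  fixes Vs W r
  assumes Vs: "Vs \<in> lists (Obj C)" and r: "r \<in> multi_hom C Vs W" and r_iso: "is_iso C r"
begin

text \<open>The map from the iterated action of \<open>Vs\<close> to the action of \<open>W\<close>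
  induced by \<open>r\<close>; \<open>comp_base_var\<close> is precomposition with its image under
  the outer actions.\<close>

definition subst_arr :: "'m \<Rightarrow> 'g" where
  "subst_arr X = (r \<triangleright>\<^sub>a Ide M X) \<cdot> inverse_arrow M (spread C M Vs X)"

lemma r_arr [simp]: "r \<in> Arr C" "Dom C r = tens_list C Vs" "Cod C r = W"
  "W \<in> Obj C" "tens_list C Vs \<in> Obj C"
  using r C.tens_list_obj[OF Vs] by (auto simp: multi_hom_def Hom_iff)

context
  fixes X
  assumes X [simp]: "X \<in> Obj M"
begin

lemma spread_inverse: "inverse_arrows M (spread C M Vs X) (inverse_arrow M (spread C M Vs X))"
  by (rule M.inverse_arrows_inverse_arrow[OF spread_iso[OF Vs X]])

lemma spread_arr [simp]: "spread C M Vs X \<in> Arr M" "Dom M (spread C M Vs X) = tens_list C Vs \<triangleright> X"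
  "Cod M (spread C M Vs X) = act_list M Vs X"
  using spread_hom[OF Vs X] by (auto simp: Hom_iff)

lemma spread_inverse_arr [simp]: "inverse_arrow M (spread C M Vs X) \<in> Arr M"
  "Dom M (inverse_arrow M (spread C M Vs X)) = act_list M Vs X"
  "Cod M (inverse_arrow M (spread C M Vs X)) = tens_list C Vs \<triangleright> X"
  using M.inverse_arrows_arr[OF spread_inverse] by auto

lemma subst_arr_arr [simp]: "subst_arr X \<in> Arr M" "Dom M (subst_arr X) = act_list M Vs X"
  "Cod M (subst_arr X) = W \<triangleright> X"
  by (auto simp: subst_arr_def)

lemma subst_arr_inverse: "\<exists>s. inverse_arrows M (subst_arr X) s"
proof -
  obtain r' where "inverse_arrows C r r'"
    using r_iso by (auto simp: is_iso_def)
  then have "inverse_arrows M (r \<triangleright>\<^sub>a Ide M X) (r' \<triangleright>\<^sub>a Ide M X)"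
    by (intro action.bifun_inverse_arrows M.inverse_arrows_ide) auto
  then show ?thesis
    unfolding subst_arr_def
    using M.inverse_arrows_cmp[OF M.inverse_arrows_sym[OF spread_inverse]] by fastforce
qed

text \<open>Paste the square of \<open>spread_lax\<close>, with \<open>spread\<close> inverted, to
  naturality of \<open>lax\<close> in the variable of \<open>C\<close>.\<close>

lemma subst_arr_lax:
  "T_a T (subst_arr X) \<cdot> lax_list C M T Vs X = lax T W X \<cdot> subst_arr (T_o T X)"
proof -
  interpret Vs: lax_endofunctor K M "T_o T" "T_a T" "mu T" "eta T"
    "act_list M Vs" "act_list_arr C M Vs" "lax_list C M T Vs"
    by (rule lax_endofunctor_act_list[OF Vs])
  have TX: "T_o T X \<in> Obj M"
    by simp
  have inv: "inverse_arrows M (spread C M Vs (T_o T X)) (inverse_arrow M (spread C M Vs (T_o T X)))"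
    by (rule M.inverse_arrows_inverse_arrow[OF spread_iso[OF Vs TX]])
  note [simp] = M.inverse_arrows_arr(1-4)[OF inv]
  have [simp]: "Dom M (spread C M Vs (T_o T X)) = tens_list C Vs \<triangleright> T_o T X"
    "Cod M (spread C M Vs (T_o T X)) = act_list M Vs (T_o T X)"
    using spread_hom[OF Vs TX] by (auto simp: Hom_iff)
  have inv_lax: "T_a T (inverse_arrow M (spread C M Vs X)) \<cdot> lax_list C M T Vs X =
      lax T (tens_list C Vs) X \<cdot> inverse_arrow M (spread C M Vs (T_o T X))"
    by (rule M.inverse_arrows_square[symmetric, OF inv T.fun_inverse_arrows[OF spread_inverse]])
      (auto simp: spread_lax[OF Vs X])
  have r_lax: "lax T W X \<cdot> (r \<triangleright>\<^sub>a Ide M (T_o T X)) = T_a T (r \<triangleright>\<^sub>a Ide M X) \<cdot> lax T (tens_list C Vs) X"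
    using lax_natural[of r "tens_list C Vs" W "Ide M X" X X] by (simp add: Hom_iff T.fun_ide)
  show ?thesis
    by (simp add: subst_arr_def T.fun_cmp_arr inv_lax M.cmp_eq_cmp[OF r_lax])
qed

end

text \<open>The inverse of \<open>spread\<close> is natural because \<open>spread\<close> is, and
  \<open>r\<close> and \<open>x\<close> act in different variables and so commute.\<close>

lemma subst_arr_natural:
  assumes x: "x \<in> Hom M X Y"
  shows "(Ide C W \<triangleright>\<^sub>a x) \<cdot> subst_arr X = subst_arr Y \<cdot> act_list_arr C M Vs x"
proof -
  interpret Vs: linear_functor K M M "act_list M Vs" "act_list_arr C M Vs"
    by (rule linear_functor_act_list[OF Vs])
  have [simp]: "x \<in> Arr M" "Dom M x = X" "Cod M x = Y" and obj [simp]: "X \<in> Obj M" "Y \<in> Obj M"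
    using x by (auto simp: Hom_iff)
  have "(Ide C (tens_list C Vs) \<triangleright>\<^sub>a x) \<cdot> inverse_arrow M (spread C M Vs X) =
      inverse_arrow M (spread C M Vs Y) \<cdot> act_list_arr C M Vs x"
    by (rule M.inverse_arrows_square[OF spread_inverse[OF obj(1)] spread_inverse[OF obj(2)]
          spread_natural[OF Vs x]]) auto
  then have "(r \<triangleright>\<^sub>a Ide M Y) \<cdot> ((Ide C (tens_list C Vs) \<triangleright>\<^sub>a x) \<cdot> inverse_arrow M (spread C M Vs X)) =
      (r \<triangleright>\<^sub>a Ide M Y) \<cdot> (inverse_arrow M (spread C M Vs Y) \<cdot> act_list_arr C M Vs x)"
    by simp
  then show ?thesis
    by (simp add: subst_arr_def action.bifun_cmp_arr_assoc)
qed

lemma universal_base_multimorphism_iso: "universal_base_multimorphism C M T Vs W r"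
  unfolding universal_base_multimorphism_def
proof (intro conjI ballI)
  fix Us Us' X Y
  assume Us: "Us \<in> lists (Obj C)" and Us': "Us' \<in> lists (Obj C)"
    and "X \<in> EM_obj M T" "Y \<in> EM_obj M T"
  then obtain X' a Y' b where XY: "X = (X', a)" "Y = (Y', b)" and [simp]: "X' \<in> Obj M" "Y' \<in> Obj M"
    and a: "a \<in> Hom M (T_o T X') X'" and b: "b \<in> Hom M (T_o T Y') Y'"
    by (auto simp: EM_obj_def)
  have [simp]: "a \<in> Arr M" "Dom M a = T_o T X'" "Cod M a = X'"
    using a by (auto simp: Hom_iff)
  interpret linear_monad K M "T_o T" "T_a T" "mu T" "eta T"
    by (rule linear_monad)
  interpret U: lax_endofunctor K M "T_o T" "T_a T" "mu T" "eta T"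
    "act_list M Us" "act_list_arr C M Us" "lax_list C M T Us"
    by (rule lax_endofunctor_act_list[OF Us])
  interpret U': lax_endofunctor K M "T_o T" "T_a T" "mu T" "eta T"
    "act_list M Us'" "act_list_arr C M Us'" "lax_list C M T Us'"
    by (rule lax_endofunctor_act_list[OF Us'])
  interpret V: lax_endofunctor K M "T_o T" "T_a T" "mu T" "eta T"
    "act_list M Vs" "act_list_arr C M Vs" "lax_list C M T Vs"
    by (rule lax_endofunctor_act_list[OF Vs])
  interpret W: lax_endofunctor K M "T_o T" "T_a T" "mu T" "eta T"
    "\<lambda>X. W \<triangleright> X" "\<lambda>x. Ide C W \<triangleright>\<^sub>a x" "lax T W"
    by (rule lax_endofunctor_act) simp
  have WUs': "W # Us' \<in> lists (Obj C)" and VsUs': "Vs @ Us' \<in> lists (Obj C)"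
    using Us' Vs by auto
  interpret UV: lax_endofunctor K M "T_o T" "T_a T" "mu T" "eta T"
    "act_list M (Us @ Vs @ Us')" "act_list_arr C M (Us @ Vs @ Us')" "lax_list C M T (Us @ Vs @ Us')"
    by (rule lax_endofunctor_act_list) (use Us Vs Us' in auto)
  interpret UW: lax_endofunctor K M "T_o T" "T_a T" "mu T" "eta T"
    "act_list M (Us @ W # Us')" "act_list_arr C M (Us @ W # Us')" "lax_list C M T (Us @ W # Us')"
    by (rule lax_endofunctor_act_list) (use Us Us' in auto)
  \<comment> \<open>Components at \<open>X'\<close> and at \<open>T_o T X'\<close> are both needed,
    since the two sides of the linearity condition start from the iterated action on
    \<open>T_o T X'\<close>.\<close>
  define th where "th Z = act_list_arr C M Us (subst_arr (act_list M Us' Z))" for Z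
  obtain s s\<^sub>T where "inverse_arrows M (th X') s" "inverse_arrows M (th (T_o T X')) s\<^sub>T"
    unfolding th_def
    using U.F.fun_inverse_arrows subst_arr_inverse[of "act_list M Us' X'"]
      subst_arr_inverse[of "act_list M Us' (T_o T X')"] by fastforce
  then have "bij_betw (\<lambda>f. f \<cdot> th X') (multilinear C M T (Us @ W # Us') X Y)
      (multilinear C M T (Us @ Vs @ Us') X Y)"
    unfolding multilinear_eq XY
  proof (rule bij_betw_cmp_iso)
    show "act_list_arr C M (Us @ W # Us') a \<cdot> th (T_o T X') = th X' \<cdot> act_list_arr C M (Us @ Vs @ Us') a"
      using subst_arr_natural[OF U'.F.fun_hom[OF a]]
      by (simp add: th_def act_list_arr_append flip: U.F.fun_cmp_arr)
    \<comment> \<open>Now \<open>th\<close> is moved through the three layers of the lax structure: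
      the outer by naturality, the middle by \<open>subst_arr_lax\<close>, the inner by
      \<open>subst_arr_natural\<close>.\<close>
    let ?l = "lax_list C M T Vs (act_list M Us' X') \<cdot> act_list_arr C M Vs (lax_list C M T Us' X')"
    have "T_a T (th X') \<cdot> lax_list C M T (Us @ Vs @ Us') X' =
        T_a T (th X') \<cdot> (lax_list C M T Us (act_list M Vs (act_list M Us' X')) \<cdot> act_list_arr C M Us ?l)"
      unfolding lax_list_append[OF Us VsUs' \<open>X' \<in> Obj M\<close>] lax_list_append[OF Vs Us' \<open>X' \<in> Obj M\<close>]
        act_list_append ..
    also have "\<dots> = (lax_list C M T Us (W \<triangleright> act_list M Us' X') \<cdot>
        act_list_arr C M Us (T_a T (subst_arr (act_list M Us' X')))) \<cdot> act_list_arr C M Us ?l"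
      unfolding th_def by (subst U.phi_natural_arr) auto
    also have "\<dots> = lax_list C M T Us (W \<triangleright> act_list M Us' X') \<cdot> act_list_arr C M Us
          ((T_a T (subst_arr (act_list M Us' X')) \<cdot> lax_list C M T Vs (act_list M Us' X')) \<cdot>
            act_list_arr C M Vs (lax_list C M T Us' X'))"
      by (simp add: U.F.fun_cmp_arr)
    also have "\<dots> = lax_list C M T Us (W \<triangleright> act_list M Us' X') \<cdot> act_list_arr C M Us
          (lax T W (act_list M Us' X') \<cdot> (subst_arr (T_o T (act_list M Us' X')) \<cdot>
            act_list_arr C M Vs (lax_list C M T Us' X')))"
      by (simp add: subst_arr_lax)
    also have "\<dots> = lax_list C M T (Us @ W # Us') X' \<cdot> th (T_o T X')"
      by (simp add: th_def lax_list_append[OF Us WUs'] U.F.fun_cmp_arr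
          flip: subst_arr_natural[OF U'.phi_hom[of X']])
    finally show "T_a T (th X') \<cdot> lax_list C M T (Us @ Vs @ Us') X' =
        lax_list C M T (Us @ W # Us') X' \<cdot> th (T_o T X')" .
  qed (use a b UV.F.fun_hom UW.F.fun_hom UV.phi_hom UW.phi_hom in \<open>auto simp: th_def act_list_append\<close>)
  then show "bij_betw (comp_base_var C M Us Vs Us' (fst X) r) (multilinear C M T (Us @ W # Us') X Y)
      (multilinear C M T (Us @ Vs @ Us') X Y)"
    by (simp add: comp_base_var_def[abs_def] th_def subst_arr_def XY)
qed (rule r)

end

end

section \<open>Existence of universal multimorphisms and representability\<close>

lemma preserves_coequalizers_comp:
  "preserves_coequalizers C D F \<Longrightarrow> preserves_coequalizers D E G \<Longrightarrow> preserves_coequalizers C E (\<lambda>x. G (F x))"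
  by (simp add: preserves_coequalizers_def)

text \<open>Each action of a fixed object is right exact in the module variable, and preservation
  composes along the list.\<close>

lemma preserves_coequalizers_act_list:
  assumes M: "abelian_category K M" and ex: "action_right_exact_in_both_variables K C M"
    and "Vs \<in> lists (Obj C)"
  shows "preserves_coequalizers M M (act_list_arr C M Vs)"
  using assms(3)
proof (induction Vs)
  case Nil
  show ?case
    by (simp add: preserves_coequalizers_def)
next
  case (Cons V Vs)
  have V: "right_exact_functor K M M (\<lambda>X. V \<triangleright>\<^bsub>M\<^esub> X) (\<lambda>x. Ide C V \<triangleright>\<^sub>a\<^bsub>M\<^esub> x)"
    using ex Cons.hyps unfolding action_right_exact_in_both_variables_def by simp
  show ?case
    using preserves_coequalizers_comp[OF Cons.IH right_exact_functor.right_exact_preserves_coequalizers[OF V M M]]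
    by simp
qed

text \<open>The coequalizer depends on \<open>Vs\<close> and \<open>X\<close> alone. One choice
  serves every \<open>Us\<close> because each iterated action preserves it.\<close>

lemma (in right_exact_lax_module_monad) ex_universal_module_multimorphism:
  assumes M: "abelian_category K M" and ex: "action_right_exact_in_both_variables K C M"
    and Vs: "Vs \<in> lists (Obj C)" and X: "X \<in> EM_obj M T"
  shows "\<exists>Z \<in> EM_obj M T. \<exists>p. universal_module_multimorphism C M T Vs X Z p"
proof -
  interpret M: abelian_category K M
    by (rule M)
  interpret V: lax_endofunctor K M "T_o T" "T_a T" "mu T" "eta T"
    "act_list M Vs" "act_list_arr C M Vs" "lax_list C M T Vs"
    by (rule lax_endofunctor_act_list[OF Vs])
  have EM: "EM_obj M T = V.algebras"
    unfolding EM_obj_def V.algebras_def ..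
  obtain X' a where X_eq: "X = (X', a)"
    by (cases X)
  then have Xa: "(X', a) \<in> V.algebras"
    using X EM by simp
  have T: "preserves_coequalizers M M (T_a T)"
    by (rule right_exact_preserves_coequalizers[OF M.abelian_category_axioms M.abelian_category_axioms])
  obtain q where q: "is_coequalizer M q (mu T (act_list M Vs X') \<cdot>\<^bsub>M\<^esub> T_a T (lax_list C M T Vs X'))
      (T_a T (act_list_arr C M Vs a))"
    using M.ex_coequalizer[OF V.parallel[OF Xa]] by blast
  obtain z where Z: "(Cod M q, z) \<in> V.algebras" and zq: "z \<cdot>\<^bsub>M\<^esub> T_a T q = q \<cdot>\<^bsub>M\<^esub> mu T (act_list M Vs X')"
    using V.coequalizer_algebra[OF Xa T q] by blast
  let ?p = "q \<cdot>\<^bsub>M\<^esub> eta T (act_list M Vs X')"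
  have "universal_module_multimorphism C M T Vs X (Cod M q, z) ?p"
    unfolding universal_module_multimorphism_def
  proof (intro conjI ballI)
    show "?p \<in> multilinear C M T Vs X (Cod M q, z)"
      using V.coequalizer_lax_linear[OF Xa q Z zq] by (simp add: multilinear_eq X_eq)
    fix Us Y
    assume Us: "Us \<in> lists (Obj C)" and "Y \<in> EM_obj M T"
    then obtain Y' b where Y_eq: "Y = (Y', b)" and Y: "(Y', b) \<in> V.algebras"
      unfolding EM by (cases Y) auto
    interpret UV: lax_endofunctor_pair K M "T_o T" "T_a T" "mu T" "eta T"
      "act_list M Vs" "act_list_arr C M Vs" "lax_list C M T Vs"
      "act_list M Us" "act_list_arr C M Us" "lax_list C M T Us"
      by (rule lax_endofunctor_pair_act_list[OF Us Vs])
    show "bij_betw (comp_module_var C M Us ?p) (multilinear C M T Us (Cod M q, z) Y)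
        (multilinear C M T (Us @ Vs) X Y)"
      using UV.coequalizer_universal[OF Xa Y T preserves_coequalizers_act_list[OF M ex Us] q Z zq]
        V.algebras_arr(1)[OF Xa]
      by (simp add: multilinear_append[OF Us Vs] multilinear_eq[of Us] X_eq Y_eq comp_module_var_def[abs_def])
  qed
  then show ?thesis
    using Z EM by blast
qed

theorem proposition3p35:
  fixes K :: "('k, 'r) ring_scheme"
    and C :: "('k, 'c, 'f, 'e) moncat_scheme"
    and M :: "('k, 'm, 'g, 'c, 'f, 'd) modcat_scheme"
    and T :: "('c, 'm, 'g, 't) lax_monad_scheme"
    and R :: "'c list \<Rightarrow> 'c \<times> 'f"
  assumes "abelian_monoidal_category K C"
    and "abelian_module_category K C M"
    and "action_right_exact_in_both_variables K C M"
    and "right_exact_lax_module_monad K C M T"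
    and "is_representation C R"
  shows "multiactegory_representable C M T R"
proof -
  interpret right_exact_lax_module_monad K C M T
    by fact
  \<comment> \<open>The chosen multimorphisms of a representation are isomorphisms, which settles
    the condition on the base.\<close>
  show ?thesis
    unfolding multiactegory_representable_def
    using ex_universal_module_multimorphism[OF abelian_module_category.axioms(2)[OF assms(2)] assms(3)] assms(5)
    by (auto simp: is_representation_def intro!: universal_base_multimorphism_iso)
qed

end
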